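(* Let $G=(V\cup\{s\},E)$ be a finite, connected multigraph with sink $s$, let $W\subset V$, and let $\xi$ be a minimal configuration on $W$. Then there exists a subset $\mathcal{E}$ of the set of edges of $G$ touching $W$ (i.e. having at least one endpoint in $W$) such that $$\nu_G[\eta:\eta_W=\xi]=\det\big(K_G(e,f)\big)_{e,f\in\mathcal{E}}.$$ The statement remains true if $\xi$ is only assumed to be a generalized minimal configuration on $W$.
   Context: Let $G=(V\cup\{s\},E)$ be a finite connected multigraph (multiple edges allowed, no loops) with distinguished vertex $s\notin V$, the sink. Sandpiles. A sandpile on $G$ is a map $\eta:V\to\{0,1,2,\dots\}$. It is stable if $\eta(x)<\deg_G(x)$ for all $x\in V$ (degrees count multiplicity). A vertex $x\in V$ with $\eta(x)\ge\deg_G(x)$ can topple: it sends one particle along each edge incident with $x$; particles reaching $s$ are lost. Consider the Markov chain on stable sandpiles in which at each step a particle is added at a uniformly random vertex of $V$ and all possible topplings are carried out until a stable sandpile is reached (the result does not depend on the order of topplings). Let $\mathcal{R}_G$ be its set of recurrent states (recurrent sandpiles). The chain has a unique stationary distribution, denoted $\nu_G$, which is the uniform distribution on $\mathcal{R}_G$. For $W\subset V$, $\eta_W$ denotes the restriction of $\eta$ to $W$, and $\delta_w$ denotes the sandpile with a single particle at $w$ and no others. Minimal configurations. Let $\emptyset\ne W\subset V$ and let $\xi$ be a stable configuration on $W$, i.e. $\xi:W\to\{0,1,2,\dots\}$ with $\xi(w)<\deg_G(w)$ for $w \in W$. Then $\xi$ is generalized minimal if there exists $\eta\in\mathcal{R}_G$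 with $\eta_W=\xi$, and for any such $\eta$ and any $w\in W$ we have $\eta-\delta_w\notin\mathcal{R}_G$. (In particular this holds at $w$ when $\eta(w)=0$, since $\eta-\delta_w$ is then not a sandpile.) It is minimal if, in addition, the graph $G\setminus W$ obtained from $G$ by removing the vertices in $W$ is connected. Transfer current matrix. Choose an orientation of each edge of $G$, and regard each edge as a wire of unit resistance. For an edge $e$, let $I^e(f)$ be the amount of current flowing through $f$ (signed with respect to the orientation of $f$) when a battery is connected between the endpoints of $e$ so that in the network as a whole unit current flows from the tail of $e$ to the head of $e$. Equivalently, $I^e(f)=h(\text{tail of }f)-h(\text{head of }f)$, where $h:V\cup\{s\}\to\mathbb{R}$ is a function for which the net flow $\sum_{f}\pm I^e(f)$ out of a vertex equals $1$ at the tail of $e$, $-1$ at the head of $e$, and $0$ at all other vertices. Set $Y_G(e,f):=I^e(f)$ (the transfer current matrix, indexed by the edges of $G$) and $K_G(e,f):=\delta_G(e,f)-Y_G(e,f)$, where $\delta_G$ is the identity matrix. The determinant does not depend on the chosen orientation. The determinant of the empty matrix is $1$. *)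

theory Defs
  imports
    "HOL-Probability.Probability"
    "Jordan_Normal_Form.Determinant"
    "Graph_Theory.Graph_Theory"
begin

text \<open>
  A multigraph with a fixed (arbitrary) orientation of its edges is a digraph in the sense of
  \<^locale>\<open>wf_digraph\<close>, where several arcs may join the same two vertices. The orientation only
  enters the transfer current matrix. Connectedness is that of the underlying undirected graph.
\<close>

locale sink_multigraph = fin_digraph G + loopfree_digraph G
  for G :: "('v, 'e) pre_digraph" +
  fixes s :: 'v
  assumes connected: "Digraph_Component.connected G"
    and sink_in_verts: "s \<in> verts G"

definition nonsink :: "('v, 'e) pre_digraph \<Rightarrow> 'v \<Rightarrow> 'v set" where
  "nonsink G s = verts G - {s}"

text \<open>The degree in the undirected graph; there are no loops.\<close>

definition deg :: "('v, 'e) pre_digraph \<Rightarrow> 'v \<Rightarrow> nat" where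
  "deg G x = in_degree G x + out_degree G x"

definition edge_mult :: "('v, 'e) pre_digraph \<Rightarrow> 'v \<Rightarrow> 'v \<Rightarrow> nat" where
  "edge_mult G x y = card {e \<in> arcs G. {tail G e, head G e} = {x, y}}"

definition stable_on :: "('v, 'e) pre_digraph \<Rightarrow> 'v set \<Rightarrow> ('v \<Rightarrow> nat) \<Rightarrow> bool" where
  "stable_on G W \<xi> \<longleftrightarrow> \<xi> \<in> W \<rightarrow>\<^sub>E UNIV \<and> (\<forall>w\<in>W. \<xi> w < deg G w)"

text \<open>Legal topplings: \<open>x\<close> must be unstable, and particles sent to the sink are lost.\<close>

inductive topples :: "('v, 'e) pre_digraph \<Rightarrow> 'v \<Rightarrow> ('v \<Rightarrow> nat) \<Rightarrow> ('v \<Rightarrow> nat) \<Rightarrow> bool"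
  for G s where
  "x \<in> nonsink G s \<Longrightarrow> deg G x \<le> \<eta> x \<Longrightarrow>
    topples G s \<eta>
      (\<lambda>y \<in> nonsink G s. (if y = x then \<eta> y - deg G x else \<eta> y) + edge_mult G x y)"

definition stabilization :: "('v, 'e) pre_digraph \<Rightarrow> 'v \<Rightarrow> ('v \<Rightarrow> nat) \<Rightarrow> ('v \<Rightarrow> nat)" where
  "stabilization G s \<eta> = (THE \<zeta>. (topples G s)\<^sup>*\<^sup>* \<eta> \<zeta> \<and> stable_on G (nonsink G s) \<zeta>)"

definition sandpile_kernel ::
    "('v, 'e) pre_digraph \<Rightarrow> 'v \<Rightarrow> ('v \<Rightarrow> nat) \<Rightarrow> ('v \<Rightarrow> nat) pmf" where
  "sandpile_kernel G s \<eta> =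
    map_pmf (\<lambda>x. stabilization G s (\<eta>(x := \<eta> x + 1))) (pmf_of_set (nonsink G s))"

text \<open>
  For a Markov chain with transition kernel \<open>K\<close> started at \<open>x\<close>, \<open>first_passage K y n x\<close> is the
  probability that the first visit to \<open>y\<close> at a positive time happens at time \<open>n + 1\<close>.
\<close>

primrec first_passage :: "('a \<Rightarrow> 'a pmf) \<Rightarrow> 'a \<Rightarrow> nat \<Rightarrow> 'a \<Rightarrow> real" where
  "first_passage K y 0 x = pmf (K x) y"
| "first_passage K y (Suc n) x =
    measure_pmf.expectation (K x) (\<lambda>z. if z = y then 0 else first_passage K y n z)"

definition recurrent_state :: "('a \<Rightarrow> 'a pmf) \<Rightarrow> 'a \<Rightarrow> bool" where
  "recurrent_state K x \<longleftrightarrow> (\<lambda>n. first_passage K x n x) sums 1"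

definition recurrent_sandpiles :: "('v, 'e) pre_digraph \<Rightarrow> 'v \<Rightarrow> ('v \<Rightarrow> nat) set" where
  "recurrent_sandpiles G s =
    {\<eta>. stable_on G (nonsink G s) \<eta> \<and> recurrent_state (sandpile_kernel G s) \<eta>}"

definition stationary_sandpile :: "('v, 'e) pre_digraph \<Rightarrow> 'v \<Rightarrow> ('v \<Rightarrow> nat) pmf" where
  "stationary_sandpile G s =
    (THE \<mu>. set_pmf \<mu> \<subseteq> {\<eta>. stable_on G (nonsink G s) \<eta>} \<and>
            bind_pmf \<mu> (sandpile_kernel G s) = \<mu>)"

text \<open>
  If \<open>\<eta> w = 0\<close> then removing a particle at \<open>w\<close> does not give a sandpile; this case has to be
  singled out because subtraction on \<^typ>\<open>nat\<close> is truncated.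
\<close>

definition generalized_minimal ::
    "('v, 'e) pre_digraph \<Rightarrow> 'v \<Rightarrow> 'v set \<Rightarrow> ('v \<Rightarrow> nat) \<Rightarrow> bool" where
  "generalized_minimal G s W \<xi> \<longleftrightarrow>
    W \<noteq> {} \<and> W \<subseteq> nonsink G s \<and> stable_on G W \<xi> \<and>
    (\<exists>\<eta>\<in>recurrent_sandpiles G s. restrict \<eta> W = \<xi>) \<and>
    (\<forall>\<eta>\<in>recurrent_sandpiles G s. restrict \<eta> W = \<xi> \<longrightarrow>
      (\<forall>w\<in>W. \<eta> w = 0 \<or> \<eta>(w := \<eta> w - 1) \<notin> recurrent_sandpiles G s))"

definition minimal_config ::
    "('v, 'e) pre_digraph \<Rightarrow> 'v \<Rightarrow> 'v set \<Rightarrow> ('v \<Rightarrow> nat) \<Rightarrow> bool" where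
  "minimal_config G s W \<xi> \<longleftrightarrow>
    generalized_minimal G s W \<xi> \<and> Digraph_Component.connected (G \<restriction> (verts G - W))"

text \<open>
  \<open>h\<close> is a voltage function for which unit current flows from the tail of \<open>e\<close> to its head
  (all resistances are 1). It is unique only up to an additive constant, but the currents are
  unique.
\<close>

definition unit_current_potential :: "('v, 'e) pre_digraph \<Rightarrow> 'e \<Rightarrow> ('v \<Rightarrow> real) \<Rightarrow> bool" where
  "unit_current_potential G e h \<longleftrightarrow>
    (\<forall>x\<in>verts G.
      (\<Sum>f\<in>out_arcs G x. h (tail G f) - h (head G f)) -
      (\<Sum>f\<in>in_arcs G x. h (tail G f) - h (head G f)) =
      of_bool (x = tail G e) - of_bool (x = head G e))"

definition transfer_current :: "('v, 'e) pre_digraph \<Rightarrow> 'e \<Rightarrow> 'e \<Rightarrow> real" where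
  "transfer_current G e f =
    (THE i. \<exists>h. unit_current_potential G e h \<and> i = h (tail G f) - h (head G f))"

definition K_matrix :: "('v, 'e) pre_digraph \<Rightarrow> 'e \<Rightarrow> 'e \<Rightarrow> real" where
  "K_matrix G e f = of_bool (e = f) - transfer_current G e f"

text \<open>
  The determinant of a matrix whose rows and columns are indexed by the finite set \<open>I\<close>; it does
  not depend on the enumeration of \<open>I\<close>, which is applied to rows and columns alike.
\<close>

definition det_on :: "'i set \<Rightarrow> ('i \<Rightarrow> 'i \<Rightarrow> 'a :: comm_ring_1) \<Rightarrow> 'a" where
  "det_on I M =
    (let is = (SOME is. distinct is \<and> set is = I)
     in Determinant.det
          (Matrix.mat (length is) (length is) (\<lambda>(i, j). M (is ! i) (is ! j))))"

definition touching_edges :: "('v, 'e) pre_digraph \<Rightarrow> 'v set \<Rightarrow> 'e set" where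
  "touching_edges G W = {e \<in> arcs G. tail G e \<in> W \<or> head G e \<in> W}"

end

theory Submission
  imports Defs "HOL-Library.Confluence"
begin

text \<open>
  The recurrent sandpiles on \<open>G\<close> are the stable sandpiles that pass the burning test; their number
  is the determinant of the reduced Laplacian \<open>L\<close>, as both satisfy the same
  deletion-contraction recursion. Choose an order in which the maximal recurrent extension of \<open>\<xi>\<close>
  burns and in which vertices outside \<open>W\<close> burn as early as possible. By minimality a vertex
  \<open>w \<in> W\<close> is burnable only after all of its neighbours that burn before it have burnt. Hence for
  each \<open>w\<close> all edges but one to the vertices that burn before \<open>w\<close> may be deleted: subtracting from
  \<open>\<eta> x\<close> the number of deleted edges from \<open>x\<close> to later vertices maps the recurrent
  extensions of \<open>\<xi>\<close> bijectively to the recurrent sandpiles on the remaining graph. With \<open>\<E>\<close> the set of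
  deleted edges and \<open>B\<close> its incidence matrix, the probability is therefore
  \<open>det (L - B B\<^sup>T) / det L = det (I - B\<^sup>T L\<^sup>-\<^sup>1 B)\<close>, and \<open>B\<^sup>T L\<^sup>-\<^sup>1 B\<close> is the transfer current matrix.
\<close>

subsection \<open>Determinants indexed by finite sets\<close>

text \<open>Once the vertices outside W carry their maximal values, each of them burns as soon as
  one neighbour has burnt, so the burning order is governed by W alone. The levels that arise are
  joined only by edges whose upper end lies in W. Keeping exactly one such edge per vertex of W
  makes it a bridge of the remaining graph, and a recurrent sandpile is maximal at the end of a
  bridge away from the sink. That is why the values on W, prescribed before the deletion, are forced
  after it. The shift depends on the graph and the levels only, so one order, found for a single
  extension, serves all of them.

  Counting comes before dynamics: the determinant of the Laplacian is nonzero because some sandpile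
  passes the burning test, and its inverse then shows that toppling terminates. The link with
  recurrence, defined by first-passage probabilities, rests on the fact that adding a particle
  permutes the sandpiles that pass the test.\<close>

abbreviation list_mat :: "'a list \<Rightarrow> 'b list \<Rightarrow> ('a \<Rightarrow> 'b \<Rightarrow> 'c) \<Rightarrow> 'c Matrix.mat" where
  "list_mat is js M \<equiv> Matrix.mat (length is) (length js) (\<lambda>(i, j). M (is ! i) (js ! j))"

text \<open>The same permutation acts on rows and on columns, so its sign occurs twice and cancels.
  This frees \<open>det_on\<close> from the enumeration picked by \<open>SOME\<close>.\<close>

lemma det_list_mat_permute:
  assumes "distinct is" "distinct js" "set is = set js"
  shows "Determinant.det (list_mat is is M) = Determinant.det (list_mat js js M)"
proof -
  have "mset is = mset js"
    using assms set_eq_iff_mset_eq_distinct by blast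
  then obtain p where p: "p permutes {..<length js}" and eq: "permute_list p js = is"
    by (rule mset_eq_permutation)
  define n where "n = length js"
  have len: "length is = n" unfolding n_def using eq by (metis length_permute_list)
  have p': "p permutes {0..<n}" using p by (simp add: n_def atLeast0LessThan)
  have nth: "is ! i = js ! p i" if "i < n" for i
    using eq that p by (metis n_def permute_list_nth)
  have pn: "p i < n" if "i < n" for i using p' that permutes_in_image[of p "{0..<n}" i] by simp
  define A where "A = list_mat js js M"
  have A: "A \<in> carrier_mat n n" unfolding A_def n_def by simp
  define B where "B = Matrix.mat n n (\<lambda>(i, j). A $$ (p i, j))"
  have B: "B \<in> carrier_mat n n" unfolding B_def by simp
  have s: "(of_int (sign p) :: 'b) * of_int (sign p) = 1"
    by (simp add: sign_def)
  have "list_mat is is M = transpose_mat (Matrix.mat n n (\<lambda>(i, j). transpose_mat B $$ (p i, j)))"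
    by (rule eq_matI) (auto simp: len B_def A_def n_def[symmetric] nth pn)
  then have "Determinant.det (list_mat is is M) =
      Determinant.det (Matrix.mat n n (\<lambda>(i, j). transpose_mat B $$ (p i, j)))"
    by (simp add: Determinant.det_transpose[of _ n])
  also have "\<dots> = of_int (sign p) * Determinant.det (transpose_mat B)"
    by (rule det_permute_rows[OF _ p']) (use B in auto)
  also have "\<dots> = of_int (sign p) * Determinant.det B"
    by (simp add: Determinant.det_transpose[OF B])
  also have "\<dots> = of_int (sign p) * (of_int (sign p) * Determinant.det A)"
    unfolding B_def by (subst det_permute_rows[OF A p']) simp
  also have "\<dots> = Determinant.det A"
    using s by (simp flip: mult.assoc)
  finally show ?thesis unfolding A_def .
qed

lemma det_on_eq_list_mat:
  assumes "distinct is" "set is = I"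
  shows "det_on I M = Determinant.det (list_mat is is M)"
proof -
  let ?js = "SOME is. distinct is \<and> set is = I"
  have "distinct ?js \<and> set ?js = I"
    by (rule someI[of _ "is"]) (use assms in simp)
  then show ?thesis
    unfolding det_on_def Let_def using assms by (intro det_list_mat_permute) auto
qed

lemma list_mat_cong:
  assumes "\<And>x y. x \<in> set is \<Longrightarrow> y \<in> set js \<Longrightarrow> M x y = N x y"
  shows "list_mat is js M = list_mat is js N"
  by (rule eq_matI) (use assms in auto)

lemma det_on_cong:
  assumes "finite I" "\<And>x y. x \<in> I \<Longrightarrow> y \<in> I \<Longrightarrow> M x y = N x y"
  shows "det_on I M = det_on I N"
proof -
  obtain "is" where "set is = I" "distinct is"
    using finite_distinct_list[OF assms(1)] by blast
  then show ?thesis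
    using assms(2) list_mat_cong[of "is" "is" M N] by (simp add: det_on_eq_list_mat)
qed

lemma det_on_empty: "det_on {} M = 1"
  by (subst det_on_eq_list_mat[of "[]"]) auto

lemma sum_set_eq_sum_nth:
  assumes "distinct js"
  shows "(\<Sum>y\<in>set js. g y) = (\<Sum>j<length js. g (js ! j))"
  using sum.reindex_bij_betw[OF bij_betw_nth[OF assms refl refl], of g] by simp

lemma list_mat_mult:
  assumes "distinct js"
  shows "list_mat is js M * list_mat js ks N = list_mat is ks (\<lambda>x z. \<Sum>y\<in>set js. M x y * N y z)"
  using assms
  by (intro eq_matI) (auto simp: scalar_prod_def sum_set_eq_sum_nth atLeast0LessThan)

lemma list_mat_one:
  assumes "distinct is"
  shows "list_mat is is (\<lambda>x y. of_bool (x = y)) = 1\<^sub>m (length is)"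
  by (rule eq_matI) (use assms in \<open>auto simp: nth_eq_iff_index_eq\<close>)

lemma det_on_mult:
  assumes "finite I"
  shows "det_on I (\<lambda>x z. \<Sum>y\<in>I. M x y * N y z) = det_on I M * det_on I N"
proof -
  obtain "is" where i: "set is = I" "distinct is"
    using finite_distinct_list[OF assms] by blast
  have "det_on I (\<lambda>x z. \<Sum>y\<in>I. M x y * N y z) = Determinant.det (list_mat is is M * list_mat is is N)"
    using i by (simp add: det_on_eq_list_mat list_mat_mult)
  then show ?thesis
    using i by (simp add: det_on_eq_list_mat Determinant.det_mult[of _ "length is"])
qed

lemma det_on_transpose:
  assumes "finite I"
  shows "det_on I (\<lambda>x y. M y x) = det_on I M"
proof -
  obtain "is" where i: "set is = I" "distinct is"
    using finite_distinct_list[OF assms] by blast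
  have "list_mat is is (\<lambda>x y. M y x) = transpose_mat (list_mat is is M)"
    by (rule eq_matI) auto
  then show ?thesis
    using i by (simp add: det_on_eq_list_mat Determinant.det_transpose[of _ "length is"])
qed

text \<open>This is Sylvester's determinant identity. Multiplying the block matrix with off-diagonal
  blocks \<open>U\<close> and \<open>B\<close> by a unipotent matrix, from the left or from the
  right, clears \<open>B\<close> and leaves one of the two sides as a diagonal block.\<close>

lemma det_one_minus_mult_commute:
  fixes U :: "'a :: idom Matrix.mat"
  assumes U: "U \<in> carrier_mat n m" and B: "B \<in> carrier_mat m n"
  shows "Determinant.det (1\<^sub>m n - U * B) = Determinant.det (1\<^sub>m m - B * U)"
proof -
  let ?P = "four_block_mat (1\<^sub>m n) U B (1\<^sub>m m)"
  let ?L = "four_block_mat (1\<^sub>m n) (0\<^sub>m n m) (- B) (1\<^sub>m m)"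
  have P: "?P \<in> carrier_mat (n + m) (n + m)" and L: "?L \<in> carrier_mat (n + m) (n + m)"
    using U B by auto
  have [simp]: "dim_row U = n" "dim_col U = m" "dim_row B = m" "dim_col B = n"
    using U B by auto
  have b: "B * U \<in> carrier_mat m m" and u: "U * B \<in> carrier_mat n n" using U B by auto
  have "?L * ?P = four_block_mat (1\<^sub>m n) U (0\<^sub>m m n) (1\<^sub>m m - B * U)"
    by (subst mult_four_block_mat[of _ n n _ m _ m _ _ n _ m])
      (use U B b in \<open>auto intro!: arg_cong2[of _ _ _ _ "four_block_mat _"] eq_matI\<close>)
  then have "Determinant.det (?L * ?P) = Determinant.det (1\<^sub>m m - B * U)"
    using det_four_block_mat_lower_left_zero[OF one_carrier_mat U refl minus_carrier_mat[OF b]] by simp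
  moreover have "?P * ?L = four_block_mat (1\<^sub>m n - U * B) U (0\<^sub>m m n) (1\<^sub>m m)"
    by (subst mult_four_block_mat[of _ n n _ m _ m _ _ n _ m])
      (use U B u in \<open>auto intro!: arg_cong2[of _ _ _ _ "\<lambda>x y. four_block_mat x U y _"] eq_matI\<close>)
  then have "Determinant.det (?P * ?L) = Determinant.det (1\<^sub>m n - U * B)"
    using det_four_block_mat_lower_left_zero[OF minus_carrier_mat[OF u] U refl one_carrier_mat] by simp
  moreover have "Determinant.det (?P * ?L) = Determinant.det (?L * ?P)"
    by (simp only: Determinant.det_mult[OF P L] Determinant.det_mult[OF L P] mult.commute)
  ultimately show ?thesis by simp
qed

lemma det_on_one_minus_mult_commute:
  fixes U :: "'a \<Rightarrow> 'b \<Rightarrow> 'c :: idom"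
  assumes "finite I" "finite J"
  shows "det_on I (\<lambda>x y. of_bool (x = y) - (\<Sum>e\<in>J. U x e * B e y)) =
    det_on J (\<lambda>e f. of_bool (e = f) - (\<Sum>x\<in>I. B e x * U x f))"
proof -
  obtain "is" js where i: "set is = I" "distinct is" and j: "set js = J" "distinct js"
    using finite_distinct_list assms by metis
  have 1: "list_mat is is (\<lambda>x y. of_bool (x = y) - (\<Sum>e\<in>J. U x e * B e y)) =
      1\<^sub>m (length is) - list_mat is js U * list_mat js is B"
    unfolding list_mat_mult[OF j(2)] list_mat_one[OF i(2), symmetric] j(1)
    by (rule eq_matI) auto
  have 2: "list_mat js js (\<lambda>e f. of_bool (e = f) - (\<Sum>x\<in>I. B e x * U x f)) =
      1\<^sub>m (length js) - list_mat js is B * list_mat is js U"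
    unfolding list_mat_mult[OF i(2)] list_mat_one[OF j(2), symmetric] i(1)
    by (rule eq_matI) auto
  show ?thesis
    unfolding det_on_eq_list_mat[OF i(2,1)] det_on_eq_list_mat[OF j(2,1)] 1 2
    by (rule det_one_minus_mult_commute) auto
qed

text \<open>Expand along the row of \<open>x\<close>: the cofactors do not involve that row, the
  only one in which \<open>M\<close> and \<open>N\<close> differ, so just the diagonal cofactor is
  added.\<close>

lemma det_on_add_diag:
  assumes "finite I" "x \<in> I"
    and "\<And>y z. y \<in> I \<Longrightarrow> z \<in> I \<Longrightarrow> M y z = N y z + of_bool (y = x \<and> z = x)"
  shows "det_on I M = det_on I N + det_on (I - {x}) M"
proof -
  obtain xs where xs: "set xs = I - {x}" "distinct xs"
    using finite_distinct_list[of "I - {x}"] assms(1) by blast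
  define n where "n = Suc (length xs)"
  \<comment> \<open>Listing \<open>x\<close> first gives its row and column the number 0.\<close>
  let ?is = "x # xs"
  have i: "distinct ?is" "set ?is = I" using xs assms(2) by auto
  let ?A = "list_mat ?is ?is M" and ?B = "list_mat ?is ?is N"
  have A: "?A \<in> carrier_mat n n" and B: "?B \<in> carrier_mat n n" unfolding n_def by auto
  have nth: "?is ! k \<in> I" if "k < n" for k
    using that i(2) nth_mem[of k ?is] unfolding n_def by (metis length_Cons)
  have eq0: "?is ! k = x \<longleftrightarrow> k = 0" if "k < n" for k
    using that i(1) unfolding n_def by (metis length_Cons nth_Cons_0 nth_eq_iff_index_eq zero_less_Suc)
  have ent: "?A $$ (k, l) = ?B $$ (k, l) + of_bool (k = 0 \<and> l = 0)" if "k < n" "l < n" for k l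
  proof -
    have "k < length ?is" "l < length ?is" using that by (auto simp: n_def)
    then have "?A $$ (k, l) = M (?is ! k) (?is ! l)" "?B $$ (k, l) = N (?is ! k) (?is ! l)"
      by (auto)
    then show ?thesis using assms(3)[OF nth nth, OF that] eq0[OF that(1)] eq0[OF that(2)] by simp
  qed
  have cof: "cofactor ?A 0 j = cofactor ?B 0 j" if "j < n" for j
  proof -
    have "mat_delete ?A 0 j = mat_delete ?B 0 j"
    proof (rule eq_matI, goal_cases)
      case (1 k l)
      then have kl: "k < length xs" "l < length xs" by auto
      let ?l = "if l < j then l else Suc l"
      have "?A $$ (Suc k, ?l) = ?B $$ (Suc k, ?l)"
        by (subst ent) (use kl in \<open>auto simp: n_def\<close>)
      then show ?case using kl by (simp add: mat_delete_def)
    qed auto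
    then show ?thesis by (simp add: cofactor_def)
  qed
  have del: "mat_delete ?A 0 0 = list_mat xs xs M"
    by (rule eq_matI) (auto simp: mat_delete_def)
  have "0 < n" by (simp add: n_def)
  have "Determinant.det ?A = (\<Sum>j<n. ?A $$ (0, j) * cofactor ?A 0 j)"
    by (rule laplace_expansion_row[OF A \<open>0 < n\<close>])
  also have "\<dots> = (\<Sum>j<n. ?B $$ (0, j) * cofactor ?B 0 j + of_bool (j = 0) * cofactor ?A 0 0)"
    by (rule sum.cong[OF refl], subst ent) (use cof in \<open>auto simp: n_def algebra_simps\<close>)
  also have "\<dots> = (\<Sum>j<n. ?B $$ (0, j) * cofactor ?B 0 j) + cofactor ?A 0 0"
  proof -
    have "(\<Sum>j<n. of_bool (j = 0) * cofactor ?A 0 0) = cofactor ?A 0 0"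
      using \<open>0 < n\<close> by (subst sum.remove[of _ 0]) auto
    then show ?thesis by (simp add: sum.distrib)
  qed
  also have "(\<Sum>j<n. ?B $$ (0, j) * cofactor ?B 0 j) = Determinant.det ?B"
    by (rule laplace_expansion_row[OF B \<open>0 < n\<close>, symmetric])
  also have "cofactor ?A 0 0 = Determinant.det (list_mat xs xs M)"
    unfolding cofactor_def del by simp
  finally show ?thesis
    using i xs by (simp only: det_on_eq_list_mat)
qed

text \<open>The vector of ones lies in the kernel.\<close>

lemma det_on_eq_0_if_row_sums_eq_0:
  fixes M :: "'a \<Rightarrow> 'a \<Rightarrow> 'b :: idom"
  assumes "finite I" "I \<noteq> {}" "\<And>x. x \<in> I \<Longrightarrow> (\<Sum>y\<in>I. M x y) = 0"
  shows "det_on I M = 0"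
proof -
  obtain "is" where i: "set is = I" "distinct is"
    using finite_distinct_list[OF assms(1)] by blast
  let ?n = "length is" and ?A = "list_mat is is M"
  let ?v = "Matrix.vec ?n (\<lambda>_. 1 :: 'b)"
  have "0 < ?n" using i assms(2) by auto
  then have "?v \<noteq> 0\<^sub>v ?n" by (metis index_vec index_zero_vec(1) zero_neq_one)
  moreover have "?A *\<^sub>v ?v = 0\<^sub>v ?n"
  proof (rule eq_vecI, goal_cases)
    case (1 k)
    then have "is ! k \<in> I" using i by auto
    with 1 show ?case using assms(3)[of "is ! k"] sum_set_eq_sum_nth[OF i(2), of "M (is ! k)"] i(1)
      by (auto simp: scalar_prod_def atLeast0LessThan)
  qed auto
  ultimately have "Determinant.det ?A = 0"
    using det_0_iff_vec_prod_zero[of ?A ?n] by (meson mat_carrier vec_carrier)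
  then show ?thesis using i by (simp add: det_on_eq_list_mat)
qed

lemma det_on_nonzero_inverse:
  fixes M :: "'a \<Rightarrow> 'a \<Rightarrow> 'b :: field"
  assumes "finite I" "det_on I M \<noteq> 0"
  obtains N where "\<And>x z. x \<in> I \<Longrightarrow> z \<in> I \<Longrightarrow> (\<Sum>y\<in>I. M x y * N y z) = of_bool (x = z)"
proof -
  obtain "is" where i: "set is = I" "distinct is"
    using finite_distinct_list[OF assms(1)] by blast
  let ?n = "length is" and ?A = "list_mat is is M"
  have A: "?A \<in> carrier_mat ?n ?n" by simp
  have d: "Determinant.det ?A \<noteq> 0" using assms(2) i by (simp add: det_on_eq_list_mat)
  define idx where "idx = inv_into {..<?n} ((!) is)"
  have idx: "idx x < ?n" "is ! idx x = x" if "x \<in> I" for x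
    using that inv_into_into[of x "(!) is" "{..<?n}"] f_inv_into_f[of x "(!) is" "{..<?n}"] i
    unfolding idx_def by (auto simp: set_conv_nth)
  have idx': "idx (is ! k) = k" if "k < ?n" for k
    unfolding idx_def using that i(2) by (simp add: inj_on_nth)
  note adj = adj_mat[OF A]
  have "(\<Sum>y\<in>I. M x y * (adj_mat ?A $$ (idx y, idx z) / Determinant.det ?A)) = of_bool (x = z)"
    if xz: "x \<in> I" "z \<in> I" for x z
  proof -
    have "(?A * adj_mat ?A) $$ (idx x, idx z) = (\<Sum>k<?n. M x (is ! k) * adj_mat ?A $$ (k, idx z))"
      using adj(1) idx[OF xz(1)] idx[OF xz(2)] by (auto simp: scalar_prod_def atLeast0LessThan)
    also have "\<dots> = (\<Sum>y\<in>I. M x y * adj_mat ?A $$ (idx y, idx z))"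
      unfolding i(1)[symmetric] sum_set_eq_sum_nth[OF i(2)] by (auto simp: idx' intro!: sum.cong)
    finally have "(\<Sum>y\<in>I. M x y * adj_mat ?A $$ (idx y, idx z)) =
        (Determinant.det ?A \<cdot>\<^sub>m 1\<^sub>m ?n) $$ (idx x, idx z)"
      unfolding adj(2) by (rule sym)
    also have "\<dots> = Determinant.det ?A * of_bool (idx x = idx z)"
      using idx(1)[OF xz(1)] idx(1)[OF xz(2)] by simp
    finally have "(\<Sum>y\<in>I. M x y * adj_mat ?A $$ (idx y, idx z)) =
        Determinant.det ?A * of_bool (idx x = idx z)" .
    moreover have "idx x = idx z \<longleftrightarrow> x = z" using idx(2) xz by metis
    ultimately show ?thesis using d by (simp flip: sum_divide_distrib)
  qed
  then show thesis by (rule that)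
qed

subsection \<open>Counting sandpiles\<close>

context sink_multigraph
begin

definition edge_count :: "'e set \<Rightarrow> 'v \<Rightarrow> 'v set \<Rightarrow> nat" where
  "edge_count A x F =
    card {e \<in> A. tail G e = x \<and> head G e \<in> F \<or> head G e = x \<and> tail G e \<in> F}"

text \<open>If this fails for \<open>F\<close>, then \<open>F\<close> is a forbidden
  subconfiguration: every vertex of \<open>F\<close> has fewer particles than edges into
  \<open>F\<close>, so none of them can be the first of \<open>F\<close> to burn.\<close>

definition burnable :: "'e set \<Rightarrow> 'v set \<Rightarrow> ('v \<Rightarrow> nat) \<Rightarrow> bool" where
  "burnable A U \<eta> \<longleftrightarrow> (\<forall>F\<subseteq>U. F \<noteq> {} \<longrightarrow> (\<exists>x\<in>F. edge_count A x F \<le> \<eta> x))"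

text \<open>All vertices outside \<open>U\<close> act together as a sink, and \<open>A\<close> is
  any set of edges. The recursion needs this freedom: it deletes single edges and moves vertices of
  \<open>U\<close> into the sink.\<close>

definition allowed :: "'e set \<Rightarrow> 'v set \<Rightarrow> ('v \<Rightarrow> nat) set" where
  "allowed A U =
    {\<eta> \<in> U \<rightarrow>\<^sub>E UNIV. (\<forall>x\<in>U. \<eta> x < edge_count A x UNIV) \<and> burnable A U \<eta>}"

text \<open>With indices restricted to \<open>U\<close> this is the Laplacian reduced by the
  complement of \<open>U\<close>, since the diagonal also counts the edges that leave
  \<open>U\<close>.\<close>

definition laplacian :: "'e set \<Rightarrow> 'v \<Rightarrow> 'v \<Rightarrow> real" where
  "laplacian A x y =
    (if x = y then real (edge_count A x UNIV) else - real (edge_count A x {y}))"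

lemma finite_arc_subset: "A \<subseteq> arcs G \<Longrightarrow> finite A"
  using finite_arcs by (rule rev_finite_subset)

lemma edge_count_mono:
  assumes "A \<subseteq> arcs G" "F \<subseteq> F'"
  shows "edge_count A x F \<le> edge_count A x F'"
  unfolding edge_count_def
  by (rule card_mono) (use assms finite_arc_subset in auto)

lemma edge_count_Un:
  assumes "A \<subseteq> arcs G" "F \<inter> F' = {}"
  shows "edge_count A x (F \<union> F') = edge_count A x F + edge_count A x F'"
proof -
  have fin: "finite A" using assms(1) by (rule finite_arc_subset)
  let ?S = "\<lambda>F. {e \<in> A. tail G e = x \<and> head G e \<in> F \<or> head G e = x \<and> tail G e \<in> F}"
  have "?S (F \<union> F') = ?S F \<union> ?S F'" by auto
  moreover have "?S F \<inter> ?S F' = {}"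
    using assms no_loops by fastforce
  ultimately show ?thesis
    unfolding edge_count_def using fin by (simp add: card_Un_disjoint)
qed

lemma edge_count_Un_arcs:
  assumes "A \<subseteq> arcs G" "B \<subseteq> arcs G" "A \<inter> B = {}"
  shows "edge_count (A \<union> B) x F = edge_count A x F + edge_count B x F"
proof -
  have fin: "finite A" "finite B" using assms finite_arc_subset by auto
  let ?S = "\<lambda>A. {e \<in> A. tail G e = x \<and> head G e \<in> F \<or> head G e = x \<and> tail G e \<in> F}"
  have "?S (A \<union> B) = ?S A \<union> ?S B" "?S A \<inter> ?S B = {}" using assms(3) by auto
  then show ?thesis
    unfolding edge_count_def using fin by (simp add: card_Un_disjoint)
qed

lemma edge_count_sym: "edge_count A x {y} = edge_count A y {x}"
  unfolding edge_count_def by (rule arg_cong[where f = card]) auto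

lemma edge_count_empty [simp]: "edge_count A x {} = 0"
  by (simp add: edge_count_def)

lemma edge_count_self:
  assumes "A \<subseteq> arcs G"
  shows "edge_count A x {x} = 0"
proof -
  have "{e \<in> A. tail G e = x \<and> head G e \<in> {x} \<or> head G e = x \<and> tail G e \<in> {x}} = {}"
    using assms no_loops by fastforce
  then show ?thesis unfolding edge_count_def by (simp only: card.empty)
qed

lemma edge_count_eq_sum:
  assumes "A \<subseteq> arcs G" "finite F"
  shows "edge_count A x F = (\<Sum>y\<in>F. edge_count A x {y})"
  using assms(2)
proof (induction F)
  case (insert y F)
  have "edge_count A x (insert y F) = edge_count A x {y} + edge_count A x F"
    using edge_count_Un[OF assms(1), of "{y}" F x] insert by simp
  then show ?case using insert by simp
qed simp

lemma edge_count_cong: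
  assumes "\<And>e. e \<in> A \<Longrightarrow> tail G e = x \<Longrightarrow> head G e \<in> F \<longleftrightarrow> head G e \<in> F'"
    and "\<And>e. e \<in> A \<Longrightarrow> head G e = x \<Longrightarrow> tail G e \<in> F \<longleftrightarrow> tail G e \<in> F'"
  shows "edge_count A x F = edge_count A x F'"
  unfolding edge_count_def by (rule arg_cong[where f = card]) (use assms in auto)

lemma edge_count_pos:
  assumes "A \<subseteq> arcs G"
  shows "0 < edge_count A x F \<longleftrightarrow>
    (\<exists>e\<in>A. tail G e = x \<and> head G e \<in> F \<or> head G e = x \<and> tail G e \<in> F)"
  using assms finite_arc_subset[OF assms] unfolding edge_count_def
  by (subst card_gt_0_iff) auto

lemma edge_count_remove:
  assumes "A \<subseteq> arcs G" "e \<in> A"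
  shows "edge_count A x F = edge_count (A - {e}) x F +
    of_bool (tail G e = x \<and> head G e \<in> F \<or> head G e = x \<and> tail G e \<in> F)"
proof -
  have "edge_count {e} x F = of_bool (tail G e = x \<and> head G e \<in> F \<or> head G e = x \<and> tail G e \<in> F)"
    unfolding edge_count_def by (auto simp: card_1_singleton_iff)
  moreover have "A - {e} \<union> {e} = A" using assms by auto
  ultimately show ?thesis
    using edge_count_Un_arcs[of "A - {e}" "{e}" x F] assms
    by (metis Diff_disjoint Int_commute insert_subset empty_subsetI subset_iff Un_subset_iff)
qed

lemma burnable_mono:
  assumes "burnable A U \<eta>" "\<And>x. x \<in> U \<Longrightarrow> \<eta> x \<le> \<zeta> x"
  shows "burnable A U \<zeta>"
  using assms unfolding burnable_def by (meson le_trans subsetD)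

lemma burnable_subset:
  assumes "burnable A U \<eta>" "U' \<subseteq> U"
  shows "burnable A U' \<eta>"
  using assms unfolding burnable_def by (meson subset_trans)

lemma finite_allowed:
  assumes "finite U"
  shows "finite (allowed A U)"
proof (rule finite_subset)
  show "allowed A U \<subseteq> PiE U (\<lambda>x. {..<edge_count A x UNIV})"
    by (auto simp: allowed_def PiE_def extensional_def)
  show "finite (PiE U (\<lambda>x. {..<edge_count A x UNIV}))"
    using assms by (rule finite_PiE) simp
qed

lemma laplacian_row_sum:
  assumes "A \<subseteq> arcs G" "finite U" "x \<in> U"
  shows "(\<Sum>y\<in>U. laplacian A x y) = real (edge_count A x (- U))"
proof -
  have "(\<Sum>y\<in>U. laplacian A x y) =
      real (edge_count A x UNIV) - (\<Sum>y\<in>U - {x}. real (edge_count A x {y}))"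
  proof -
    have "(\<Sum>y\<in>U - {x}. laplacian A x y) = (\<Sum>y\<in>U - {x}. - real (edge_count A x {y}))"
      by (rule sum.cong) (auto simp: laplacian_def)
    then show ?thesis
      using assms by (simp add: sum.remove[of U x] sum_negf laplacian_def)
  qed
  also have "(\<Sum>y\<in>U - {x}. real (edge_count A x {y})) = real (edge_count A x U)"
    using assms by (simp add: edge_count_eq_sum[OF assms(1,2)] sum.remove[of U x] edge_count_self)
  also have "edge_count A x UNIV = edge_count A x U + edge_count A x (- U)"
    using edge_count_Un[OF assms(1), of U "- U" x] by simp
  finally show ?thesis by simp
qed

text \<open>Split by the value at \<open>x\<close>. With the maximal stable value, \<open>x\<close>
  can burn in any test set, so what is left is an allowed sandpile on \<open>U - {x}\<close>. For
  smaller values, deleting \<open>e\<close> lowers the degree of \<open>x\<close> by 1 and changes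
  no count inside \<open>U\<close>.\<close>

lemma allowed_split:
  assumes A: "A \<subseteq> arcs G" and e: "e \<in> A" "x \<in> U" "y \<notin> U"
    and ends: "tail G e = x \<and> head G e = y \<or> head G e = x \<and> tail G e = y"
    and fin: "finite U"
  shows "card (allowed A U) = card (allowed (A - {e}) U) + card (allowed A (U - {x}))"
proof -
  define d where "d = edge_count A x UNIV - 1"
  have dpos: "edge_count A x UNIV = Suc d"
  proof -
    have "0 < edge_count A x UNIV" using edge_count_pos[OF A] e ends by fastforce
    then show ?thesis by (simp add: d_def)
  qed
  \<comment> \<open>The edge \<open>e\<close> leads out of every subset of \<open>U\<close>, so at
    most \<open>d\<close> edges at \<open>x\<close> stay inside.\<close>
  have le_d: "edge_count A x F \<le> d" if "F \<subseteq> U" for F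
  proof -
    have "0 < edge_count A x (- F)"
      using that e ends by (subst edge_count_pos[OF A]) (intro bexI[of _ e]; blast)
    then show ?thesis
      using edge_count_Un[OF A, of F "- F" x] dpos by simp
  qed
  have count_Diff: "edge_count (A - {e}) z F = edge_count A z F" if "F \<subseteq> U" "z \<in> U" for z F
    using edge_count_remove[OF A e(1), of z F] that ends e by (auto simp: subset_iff)
  have deg_Diff: "edge_count (A - {e}) z UNIV = (if z = x then d else edge_count A z UNIV)"
    if "z \<in> U" for z
    using edge_count_remove[OF A e(1), of z UNIV] dpos that ends e by (auto split: if_splits)
  let ?X = "{\<eta> \<in> allowed A U. \<eta> x = d}"
  have burn: "burnable (A - {e}) U \<eta> \<longleftrightarrow> burnable A U \<eta>" for \<eta>
    unfolding burnable_def using count_Diff by (auto simp: subset_iff)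
  have "allowed (A - {e}) U = {\<eta> \<in> allowed A U. \<eta> x \<noteq> d}"
  proof (rule Set.set_eqI)
    fix \<eta>
    have "\<eta> z < edge_count (A - {e}) z UNIV \<longleftrightarrow>
        \<eta> z < edge_count A z UNIV \<and> (z = x \<longrightarrow> \<eta> x \<noteq> d)" if "z \<in> U" for z
      unfolding deg_Diff[OF that] using dpos by auto
    then have "(\<forall>z\<in>U. \<eta> z < edge_count (A - {e}) z UNIV) \<longleftrightarrow>
        (\<forall>z\<in>U. \<eta> z < edge_count A z UNIV) \<and> \<eta> x \<noteq> d"
      using e(2) by blast
    then show "\<eta> \<in> allowed (A - {e}) U \<longleftrightarrow> \<eta> \<in> {\<eta> \<in> allowed A U. \<eta> x \<noteq> d}"
      unfolding allowed_def mem_Collect_eq burn by blast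
  qed
  then have split: "allowed (A - {e}) U \<union> ?X = allowed A U" "allowed (A - {e}) U \<inter> ?X = {}"
    by auto
  have "card (allowed A U) = card (allowed (A - {e}) U) + card ?X"
    using card_Un_disjoint[OF _ _ split(2), unfolded split(1)] finite_allowed[OF fin] by simp
  moreover have "bij_betw (\<lambda>\<eta>. restrict \<eta> (U - {x})) ?X (allowed A (U - {x}))"
  proof (rule bij_betw_byWitness[where f' = "\<lambda>\<eta>. \<eta>(x := d)"])
    show "\<forall>\<eta>\<in>?X. (restrict \<eta> (U - {x}))(x := d) = \<eta>"
      by (auto simp: allowed_def fun_eq_iff PiE_def extensional_def)
    show "\<forall>\<eta>\<in>allowed A (U - {x}). restrict (\<eta>(x := d)) (U - {x}) = \<eta>"
      by (auto simp: allowed_def fun_eq_iff PiE_def extensional_def)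
    show "(\<lambda>\<eta>. restrict \<eta> (U - {x})) ` ?X \<subseteq> allowed A (U - {x})"
    proof (clarify)
      fix \<eta> assume \<eta>: "\<eta> \<in> allowed A U"
      then have "burnable A (U - {x}) \<eta>"
        unfolding allowed_def using burnable_subset[of A U \<eta> "U - {x}"] by blast
      then have "burnable A (U - {x}) (restrict \<eta> (U - {x}))"
        by (rule burnable_mono) auto
      then show "restrict \<eta> (U - {x}) \<in> allowed A (U - {x})"
        using \<eta> by (auto simp: allowed_def)
    qed
    show "(\<lambda>\<eta>. \<eta>(x := d)) ` allowed A (U - {x}) \<subseteq> ?X"
    proof (clarify)
      fix \<eta> assume \<eta>: "\<eta> \<in> allowed A (U - {x})"
      have "burnable A U (\<eta>(x := d))"
        unfolding burnable_def
      proof (intro allI impI)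
        fix F assume F: "F \<subseteq> U" "F \<noteq> {}"
        show "\<exists>z\<in>F. edge_count A z F \<le> (\<eta>(x := d)) z"
        proof (cases "x \<in> F")
          case True
          then show ?thesis using le_d[OF F(1)] by auto
        next
          case False
          then obtain z where "z \<in> F" "edge_count A z F \<le> \<eta> z"
            using \<eta> F unfolding allowed_def burnable_def by blast
          then show ?thesis using False by auto
        qed
      qed
      moreover have "\<eta>(x := d) \<in> U \<rightarrow>\<^sub>E UNIV"
        using \<eta> e(2) by (auto simp: allowed_def PiE_def extensional_def)
      ultimately show "\<eta>(x := d) \<in> allowed A U \<and> (\<eta>(x := d)) x = d"
        using \<eta> dpos by (auto simp: allowed_def)
    qed
  qed
  then have "card ?X = card (allowed A (U - {x}))"
    by (rule bij_betw_same_card)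
  ultimately show ?thesis by simp
qed

text \<open>The edge \<open>e\<close> has only one end in \<open>U\<close>, so it contributes 1 to a
  single diagonal entry and nothing else.\<close>

lemma det_laplacian_split:
  assumes A: "A \<subseteq> arcs G" and e: "e \<in> A" "x \<in> U" "y \<notin> U"
    and ends: "tail G e = x \<and> head G e = y \<or> head G e = x \<and> tail G e = y"
    and fin: "finite U"
  shows "det_on U (laplacian A) = det_on U (laplacian (A - {e})) + det_on (U - {x}) (laplacian A)"
proof (rule det_on_add_diag[OF fin e(2)])
  fix u v assume uv: "u \<in> U" "v \<in> U"
  show "laplacian A u v = laplacian (A - {e}) u v + of_bool (u = x \<and> v = x)"
    using edge_count_remove[OF A e(1), of u UNIV] edge_count_remove[OF A e(1), of u "{v}"]
      uv e ends by (auto simp: laplacian_def)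
qed

text \<open>
  Deletion and contraction of an edge joining \<open>U\<close> to its complement: both sides of the claim
  satisfy the same recursion, and both vanish if there is no such edge and \<open>U\<close> is nonempty.
\<close>

theorem card_allowed:
  assumes "A \<subseteq> arcs G" "finite U"
  shows "real (card (allowed A U)) = det_on U (laplacian A)"
  using assms
proof (induction "card U + card A" arbitrary: A U rule: less_induct)
  case less
  have finA: "finite A" using less.prems(1) by (rule finite_arc_subset)
  show ?case
  proof (cases "\<exists>e\<in>A. \<exists>x\<in>U. \<exists>y. y \<notin> U \<and>
      (tail G e = x \<and> head G e = y \<or> head G e = x \<and> tail G e = y)")
    case True
    then obtain e x y where e: "e \<in> A" "x \<in> U" "y \<notin> U"
      and ends: "tail G e = x \<and> head G e = y \<or> head G e = x \<and> tail G e = y" by blast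
    have "card (A - {e}) < card A" "card (U - {x}) < card U"
      using e finA less.prems(2) by (simp_all only: card_Diff1_less)
    then have "real (card (allowed (A - {e}) U)) = det_on U (laplacian (A - {e}))"
      "real (card (allowed A (U - {x}))) = det_on (U - {x}) (laplacian A)"
      using less.hyps[of U "A - {e}"] less.hyps[of "U - {x}" A] less.prems by auto
    then show ?thesis
      unfolding allowed_split[OF less.prems(1) e ends less.prems(2)]
        det_laplacian_split[OF less.prems(1) e ends less.prems(2)] by simp
  next
    case False
    show ?thesis
    proof (cases "U = {}")
      case True
      \<comment> \<open>The one function on the empty set matches the empty determinant 1.\<close>
      then have "allowed A U = {\<lambda>_. undefined}" by (auto simp: allowed_def burnable_def)
      then show ?thesis using True by (simp add: det_on_empty)
    next
      case nonempty: False
      \<comment> \<open>When no edge leaves \<open>U\<close>, all row sums of the Laplacian vanish,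
        and \<open>U\<close> itself is a forbidden subconfiguration of every stable
        sandpile.\<close>
      have out: "edge_count A x (- U) = 0" if "x \<in> U" for x
        using edge_count_pos[OF less.prems(1), of x "- U"] False that by fastforce
      then have "det_on U (laplacian A) = 0"
        using laplacian_row_sum[OF less.prems] less.prems(2) nonempty
        by (intro det_on_eq_0_if_row_sums_eq_0) auto
      moreover have "\<eta> \<notin> allowed A U" for \<eta>
      proof
        assume \<eta>: "\<eta> \<in> allowed A U"
        then obtain x where "x \<in> U" "edge_count A x U \<le> \<eta> x" "\<eta> x < edge_count A x UNIV"
          using nonempty unfolding allowed_def burnable_def by blast
        then show False
          using edge_count_Un[OF less.prems(1), of U "- U" x] out[of x] by simp
      qed
      then have "allowed A U = {}" by blast
      ultimately show ?thesis by simp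
    qed
  qed
qed

end

subsection \<open>Levels\<close>

context sink_multigraph
begin

definition joins :: "'e \<Rightarrow> 'v \<Rightarrow> 'v \<Rightarrow> bool" where
  "joins e x y \<longleftrightarrow> tail G e = x \<and> head G e = y \<or> head G e = x \<and> tail G e = y"

lemma joins_commute: "joins e x y \<longleftrightarrow> joins e y x"
  by (auto simp: joins_def)

lemma joins_in_verts: "e \<in> arcs G \<Longrightarrow> joins e x y \<Longrightarrow> y \<in> verts G"
  by (auto simp: joins_def)

lemma edge_count_pos_joins:
  assumes "A \<subseteq> arcs G"
  shows "0 < edge_count A x F \<longleftrightarrow> (\<exists>e\<in>A. \<exists>y\<in>F. joins e x y)"
  unfolding edge_count_pos[OF assms] joins_def by blast

lemma edge_count_cong_joins:
  assumes "\<And>e y. e \<in> A \<Longrightarrow> joins e x y \<Longrightarrow> y \<in> F \<longleftrightarrow> y \<in> F'"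
  shows "edge_count A x F = edge_count A x F'"
  by (rule edge_count_cong) (use assms in \<open>auto simp: joins_def\<close>)

lemma edge_count_le_joins:
  assumes "A \<subseteq> arcs G" "\<And>e y. e \<in> A \<Longrightarrow> joins e x y \<Longrightarrow> y \<in> F \<Longrightarrow> y \<in> F'"
  shows "edge_count A x F \<le> edge_count A x F'"
proof -
  have "edge_count A x F = edge_count A x (F \<inter> F')"
    by (rule edge_count_cong_joins) (use assms(2) in auto)
  then show ?thesis
    using edge_count_mono[OF assms(1), of "F \<inter> F'" F' x] by simp
qed

lemma edge_count_split3:
  assumes "A \<subseteq> arcs G"
  shows "edge_count A x UNIV = edge_count A x {y. (lev y :: nat) < lev x} +
    edge_count A x {y. lev y = lev x} + edge_count A x {y. lev x < lev y}"
proof -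
  have "UNIV = ({y. lev y < lev x} \<union> {y. lev y = lev x}) \<union> {y. lev x < lev y}" by auto
  then have "edge_count A x UNIV =
      edge_count A x (({y. lev y < lev x} \<union> {y. lev y = lev x}) \<union> {y. lev x < lev y})"
    by simp
  also have "\<dots> = edge_count A x ({y. lev y < lev x} \<union> {y. lev y = lev x}) +
      edge_count A x {y. lev x < lev y}"
    by (rule edge_count_Un[OF assms]) auto
  also have "edge_count A x ({y. lev y < lev x} \<union> {y. lev y = lev x}) =
      edge_count A x {y. lev y < lev x} + edge_count A x {y. lev y = lev x}"
    by (rule edge_count_Un[OF assms]) auto
  finally show ?thesis .
qed

lemma verts_eq: "verts G = insert s (nonsink G s)"
  using sink_in_verts by (auto simp: nonsink_def)

end

text \<open>
  Level \<open>lev w\<close> of \<open>w \<in> W\<close> consists of \<open>w\<close> and the vertices outside \<open>W\<close> that can burn as soon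
  as \<open>w\<close> has burnt. The last assumption expresses that \<open>w\<close> becomes burnable exactly when all its
  neighbours in lower levels have burnt.
\<close>

locale level_structure = sink_multigraph G s
  for G :: "('v, 'e) pre_digraph" and s :: 'v +
  fixes W :: "'v set" and \<xi> :: "'v \<Rightarrow> nat" and lev :: "'v \<Rightarrow> nat"
  assumes W_subset: "W \<subseteq> nonsink G s"
    and lev_sink: "lev s = 0"
    and upper_in_W: "\<And>e x y. e \<in> arcs G \<Longrightarrow> joins e x y \<Longrightarrow> lev x < lev y \<Longrightarrow> y \<in> W"
    and lev_inj: "inj_on lev W"
    and lower_neighbour: "\<And>w. w \<in> W \<Longrightarrow> 0 < edge_count (arcs G) w {y. lev y < lev w}"
    and degree_eq: "\<And>w. w \<in> W \<Longrightarrow>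
      edge_count (arcs G) w UNIV = \<xi> w + edge_count (arcs G) w {y. lev y < lev w}"
begin

text \<open>The one edge from \<open>w\<close> to a lower level that survives the deletion. If the
  levels were contracted to points, the surviving edges between them would form a forest.\<close>

definition parent :: "'v \<Rightarrow> 'e" where
  "parent w = (SOME e. e \<in> arcs G \<and> (\<exists>y. joins e w y \<and> lev y < lev w))"

definition removed :: "'e set" where
  "removed = {e \<in> arcs G. lev (tail G e) \<noteq> lev (head G e)} - parent ` W"

definition kept :: "'e set" where
  "kept = arcs G - removed"

text \<open>A deleted edge costs its lower end one particle and its upper end none; the upper end
  lies in \<open>W\<close>, where the loss of degree makes the value maximal.\<close>

definition children :: "'v \<Rightarrow> nat" where
  "children x = edge_count removed x {y. lev x < lev y}"

lemma parent:
  assumes "w \<in> W"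
  shows "parent w \<in> arcs G" "\<exists>y. joins (parent w) w y \<and> lev y < lev w"
proof -
  have "\<exists>e. e \<in> arcs G \<and> (\<exists>y. joins e w y \<and> lev y < lev w)"
    using lower_neighbour[OF assms] unfolding edge_count_pos_joins[OF subset_refl] by blast
  then have "parent w \<in> arcs G \<and> (\<exists>y. joins (parent w) w y \<and> lev y < lev w)"
    unfolding parent_def by (rule someI_ex)
  then show "parent w \<in> arcs G" "\<exists>y. joins (parent w) w y \<and> lev y < lev w" by auto
qed

lemma removed_subset: "removed \<subseteq> arcs G" and kept_subset: "kept \<subseteq> arcs G"
  by (auto simp: removed_def kept_def)

lemma removed_touching: "removed \<subseteq> touching_edges G W"
proof
  fix e assume e: "e \<in> removed"
  then consider "lev (tail G e) < lev (head G e)" | "lev (head G e) < lev (tail G e)"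
    by (fastforce simp: removed_def)
  then have "head G e \<in> W \<or> tail G e \<in> W"
    by cases (use e upper_in_W[of e] removed_subset in \<open>auto simp: joins_def\<close>)
  then show "e \<in> touching_edges G W"
    using e removed_subset by (auto simp: touching_edges_def)
qed

lemma edge_count_arcs: "edge_count (arcs G) x F = edge_count kept x F + edge_count removed x F"
proof -
  have "arcs G = kept \<union> removed" using removed_subset by (auto simp: kept_def)
  then show ?thesis
    using edge_count_Un_arcs[OF kept_subset removed_subset, of x F] by (auto simp: kept_def)
qed

lemma edge_count_removed_same: "edge_count removed x {y. lev y = lev x} = 0"
  using edge_count_pos_joins[OF removed_subset, of x "{y. lev y = lev x}"]
  by (fastforce simp: removed_def joins_def)

lemma edge_count_lower:
  assumes "A \<subseteq> arcs G" "x \<notin> W"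
  shows "edge_count A x {y. lev y < lev x} = 0"
  using edge_count_pos_joins[OF assms(1), of x "{y. lev y < lev x}"] assms
    upper_in_W[of _ _ x] joins_commute by blast

lemma edge_count_kept_lower:
  assumes "w \<in> W"
  shows "edge_count kept w {y. lev y < lev w} = 1"
proof -
  have "{e \<in> kept. \<exists>y. lev y < lev w \<and> joins e w y} = {parent w}"
  proof (intro equalityI subsetI)
    fix e assume "e \<in> {e \<in> kept. \<exists>y. lev y < lev w \<and> joins e w y}"
    then obtain y where e: "e \<in> kept" "joins e w y" "lev y < lev w" by blast
    then have "e \<in> parent ` W"
      by (auto simp: kept_def removed_def joins_def)
    then obtain w' where w': "w' \<in> W" "e = parent w'" by blast
    then obtain y' where "joins e w' y'" "lev y' < lev w'" using parent(2) by blast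
    \<comment> \<open>The level decreases along \<open>e\<close> from \<open>w\<close> as well as
      from \<open>w'\<close>, so both are the upper end of \<open>e\<close>.\<close>
    then have "w' = w" using e by (auto simp: joins_def)
    then show "e \<in> {parent w}" using w' by simp
  next
    fix e assume "e \<in> {parent w}"
    then show "e \<in> {e \<in> kept. \<exists>y. lev y < lev w \<and> joins e w y}"
      using parent[OF assms] assms by (auto simp: kept_def removed_def)
  qed
  moreover have "edge_count kept w {y. lev y < lev w} =
      card {e \<in> kept. \<exists>y. lev y < lev w \<and> joins e w y}"
    unfolding edge_count_def joins_def by (rule arg_cong[where f = card]) auto
  ultimately show ?thesis by simp
qed

lemma degree_kept_nonW:
  assumes "x \<notin> W"
  shows "edge_count kept x UNIV + children x = edge_count (arcs G) x UNIV"
  unfolding children_def edge_count_arcs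
  using edge_count_split3[OF removed_subset, of x lev] edge_count_lower[OF removed_subset assms]
    edge_count_removed_same by simp

text \<open>All lower edges of \<open>w\<close> but one are gone, so the shifted value
  \<open>\<xi> w - children w\<close> is exactly the largest stable value in the remaining
  graph.\<close>

lemma degree_kept_W:
  assumes "w \<in> W"
  shows "edge_count kept w UNIV + children w = \<xi> w + 1"
proof -
  note [simp] = edge_count_kept_lower[OF assms] edge_count_removed_same
  have "\<xi> w = edge_count (arcs G) w {y. lev y = lev w} + edge_count (arcs G) w {y. lev w < lev y}"
    using degree_eq[OF assms] edge_count_split3[of "arcs G" w lev] by simp
  then show ?thesis
    using edge_count_split3[OF kept_subset, of w lev] by (simp add: edge_count_arcs children_def)
qed

section \<open>Descendants of a set of vertices and the bijection between sandpiles\<close>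

lemma lev_pos:
  assumes "w \<in> W"
  shows "0 < lev w"
  using parent(2)[OF assms] by auto

text \<open>Passing from a test set \<open>S\<close> to its descendants closes it upwards, one whole
  level at a time. For the sandpiles considered, the vertices added in this way are not burnable, so
  the burning test on the enlarged set produces a vertex of \<open>S\<close> itself.\<close>

inductive_set descendants :: "'e set \<Rightarrow> 'v set \<Rightarrow> 'v set" for A S where
  base: "x \<in> S \<Longrightarrow> x \<in> descendants A S"
| step: "u \<in> descendants A S \<Longrightarrow> e \<in> A \<Longrightarrow> joins e u w \<Longrightarrow> lev u < lev w \<Longrightarrow> w \<in> W \<Longrightarrow>
    y \<in> nonsink G s \<Longrightarrow> lev y = lev w \<Longrightarrow> y \<in> descendants A S"

lemma descendants_subset:
  assumes "S \<subseteq> nonsink G s"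
  shows "descendants A S \<subseteq> nonsink G s"
proof
  fix x assume "x \<in> descendants A S"
  then show "x \<in> nonsink G s" by cases (use assms in auto)
qed

lemma descendants_upper:
  assumes "A \<subseteq> arcs G" "x \<in> descendants A S" "e \<in> A" "joins e x y" "lev x < lev y"
  shows "y \<in> descendants A S"
proof -
  have "y \<in> W" by (rule upper_in_W[OF subsetD[OF assms(1,3)] assms(4,5)])
  then show ?thesis using descendants.step[OF assms(2-5)] W_subset by blast
qed

lemma descendants_same:
  assumes "A \<subseteq> arcs G" "x \<in> descendants A S" "x \<notin> S" "e \<in> A" "joins e x y" "lev y = lev x"
  shows "y \<in> descendants A S"
  using assms(2)
proof cases
  case base
  then show ?thesis using assms by simp
next
  case (step u e' w)
  have "y \<in> verts G" by (rule joins_in_verts[OF subsetD[OF assms(1,4)] assms(5)])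
  moreover have "y \<noteq> s" using assms(6) step(7) lev_sink lev_pos[OF step(5)] by fastforce
  ultimately have "y \<in> nonsink G s" by (simp add: nonsink_def)
  then show ?thesis by (rule descendants.step[OF step(1-5)]) (simp add: assms(6) step)
qed

lemma edge_count_descendants_upper:
  assumes "A \<subseteq> arcs G" "B \<subseteq> A" "x \<in> descendants A S"
  shows "edge_count B x {y. lev x < lev y} = edge_count B x (descendants A S \<inter> {y. lev x < lev y})"
proof (rule edge_count_cong_joins)
  fix e y assume "e \<in> B" "joins e x y"
  then show "y \<in> {y. lev x < lev y} \<longleftrightarrow> y \<in> descendants A S \<inter> {y. lev x < lev y}"
    using descendants_upper[OF assms(1,3) subsetD[OF assms(2)], of e y] by auto
qed

text \<open>A vertex outside \<open>S\<close> was added with its whole level, so its neighbours in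
  that level and above belong to the set as well. If it lies in \<open>W\<close>, it is the vertex
  through which the level was entered, as \<open>lev\<close> is injective on \<open>W\<close>; this
  yields one more edge, to a descendant below.\<close>

lemma edge_count_descendants_ge:
  assumes "A \<subseteq> arcs G" "x \<in> descendants A S" "x \<notin> S"
  shows "edge_count A x {y. lev y = lev x} + edge_count A x {y. lev x < lev y} + of_bool (x \<in> W)
    \<le> edge_count A x (descendants A S)"
proof -
  let ?D = "descendants A S"
  have "edge_count A x {y. lev y = lev x} = edge_count A x (?D \<inter> {y. lev y = lev x})"
  proof (rule edge_count_cong_joins)
    fix e y assume "e \<in> A" "joins e x y"
    then show "y \<in> {y. lev y = lev x} \<longleftrightarrow> y \<in> ?D \<inter> {y. lev y = lev x}"
      using descendants_same[OF assms, of e y] by auto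
  qed
  moreover have "edge_count A x {y. lev x < lev y} = edge_count A x (?D \<inter> {y. lev x < lev y})"
    by (rule edge_count_descendants_upper[OF assms(1) subset_refl assms(2)])
  moreover have "of_bool (x \<in> W) \<le> edge_count A x (?D \<inter> {y. lev y < lev x})"
  proof (cases "x \<in> W")
    case True
    from assms(2) show ?thesis
    proof cases
      case base
      then show ?thesis using assms(3) by simp
    next
      case (step u e w)
      have wx: "w = x" by (rule inj_onD[OF lev_inj step(7)[symmetric] step(5) True])
      have "joins e x u" using step(3) unfolding wx by (rule iffD1[OF joins_commute])
      moreover have "u \<in> ?D \<inter> {y. lev y < lev x}"
        using step(1,4) unfolding wx by blast
      ultimately have "0 < edge_count A x (?D \<inter> {y. lev y < lev x})"
        using step(2) edge_count_pos_joins[OF assms(1)] by blast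
      then show ?thesis by (simp add: True)
    qed
  qed simp
  moreover have "edge_count A x ?D = edge_count A x (?D \<inter> {y. lev y = lev x}) +
      edge_count A x (?D \<inter> {y. lev x < lev y}) + edge_count A x (?D \<inter> {y. lev y < lev x})"
    by (subst edge_count_Un[OF assms(1), symmetric], force,
        subst edge_count_Un[OF assms(1), symmetric], force, rule arg_cong, auto)
  ultimately show ?thesis by linarith
qed

text \<open>Apply the burning test to the descendants of \<open>F\<close> in the full graph. A
  burnable vertex outside \<open>F\<close> would carry at least its degree or, if it is some
  \<open>w\<close> in \<open>W\<close>, at least \<open>\<xi> w + 1\<close> particles. So the vertex
  found lies in \<open>F\<close>, and the test counts all its edges to higher levels, including the
  removed ones.\<close>

lemma burnable_arcs_imp_kept:
  assumes \<eta>: "\<eta> \<in> allowed (arcs G) (nonsink G s)" and W: "\<And>w. w \<in> W \<Longrightarrow> \<eta> w = \<xi> w"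
    and F: "F \<subseteq> nonsink G s" "F \<noteq> {}"
  shows "\<exists>x\<in>F. edge_count kept x F + children x \<le> \<eta> x"
proof -
  let ?D = "descendants (arcs G) F"
  have D: "?D \<subseteq> nonsink G s" "?D \<noteq> {}"
    using F(2) descendants_subset[OF F(1), of "arcs G"] descendants.base[of _ F "arcs G"] by auto
  then obtain x where x: "x \<in> ?D" "edge_count (arcs G) x ?D \<le> \<eta> x"
    using \<eta> unfolding allowed_def burnable_def by blast
  then have xV: "x \<in> nonsink G s" using D(1) by auto
  have "x \<in> F"
  proof (rule ccontr)
    assume "x \<notin> F"
    then have le: "edge_count (arcs G) x {y. lev y = lev x} +
        edge_count (arcs G) x {y. lev x < lev y} + of_bool (x \<in> W) \<le> \<eta> x"
      using edge_count_descendants_ge[OF _ x(1)] x(2) by force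
    note split = edge_count_split3[of "arcs G" x lev]
    show False
    proof (cases "x \<in> W")
      case True
      then show False using le split degree_eq[OF True] W[OF True] by simp
    next
      case False
      then have "edge_count (arcs G) x UNIV \<le> \<eta> x"
        using le split edge_count_lower[of "arcs G" x] by simp
      then show False using \<eta> xV by (auto simp: allowed_def not_le[symmetric])
    qed
  qed
  moreover have "edge_count kept x F \<le> edge_count kept x ?D"
    using kept_subset by (intro edge_count_mono) (auto intro: descendants.base)
  moreover have "children x \<le> edge_count removed x ?D"
    unfolding children_def edge_count_descendants_upper[OF subset_refl removed_subset x(1)]
    by (rule edge_count_mono[OF removed_subset]) simp
  ultimately show ?thesis using x(2) unfolding edge_count_arcs by (intro bexI[of _ x]) auto
qed

text \<open>In the remaining graph all edges of a descendant outside \<open>S\<close> lead to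
  descendants: a vertex of \<open>W\<close> has just one lower edge, the one by which its level was
  entered. In a stable sandpile such a vertex is not burnable.\<close>

lemma burnable_kept:
  assumes \<eta>: "\<eta> \<in> allowed kept (nonsink G s)" and S: "S \<subseteq> nonsink G s" "S \<noteq> {}"
  obtains x where "x \<in> S" "edge_count kept x (descendants kept S) \<le> \<eta> x"
proof -
  let ?D = "descendants kept S"
  have D: "?D \<subseteq> nonsink G s" "?D \<noteq> {}"
    using S(2) descendants_subset[OF S(1), of kept] descendants.base[of _ S kept] by auto
  then obtain x where x: "x \<in> ?D" "edge_count kept x ?D \<le> \<eta> x"
    using \<eta> unfolding allowed_def burnable_def by blast
  then have less: "\<eta> x < edge_count kept x UNIV"
    using D(1) \<eta> by (auto simp: allowed_def)
  have "x \<in> S"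
  proof (rule ccontr)
    assume "x \<notin> S"
    then have "edge_count kept x UNIV \<le> edge_count kept x ?D"
      using edge_count_descendants_ge[OF kept_subset x(1)] edge_count_lower[OF kept_subset, of x]
        edge_count_kept_lower[of x] edge_count_split3[OF kept_subset, of x lev]
      by (cases "x \<in> W") auto
    then show False using x(2) less by simp
  qed
  then show thesis using that x by blast
qed

text \<open>The edge \<open>parent w\<close> is the only kept edge that leaves the descendants of
  the level of \<open>w\<close>. So the first of them to burn is \<open>w\<close>, when only this
  edge has been burnt, and this forces the maximal stable value at \<open>w\<close>.\<close>

lemma allowed_kept_eq:
  assumes \<eta>: "\<eta> \<in> allowed kept (nonsink G s)" and w: "w \<in> W"
  shows "\<eta> w + children w = \<xi> w"
proof -
  let ?S = "{y \<in> nonsink G s. lev y = lev w}"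
  let ?D = "descendants kept ?S"
  have "w \<in> ?S" using w W_subset by auto
  then obtain x where x: "x \<in> ?S" "edge_count kept x ?D \<le> \<eta> x"
    using burnable_kept[OF \<eta>, of ?S] by auto
  have xD: "x \<in> ?D" using x(1) by (rule descendants.base)
  have "edge_count kept x {y. lev y = lev x} + edge_count kept x {y. lev x < lev y}
      = edge_count kept x {y. lev x \<le> lev y}"
    by (subst edge_count_Un[OF kept_subset, symmetric]) (auto intro!: arg_cong[where f = "edge_count kept x"])
  also have "\<dots> \<le> edge_count kept x ?D"
  proof (rule edge_count_le_joins[OF kept_subset])
    fix e y assume e: "e \<in> kept" "joins e x y" and "y \<in> {y. lev x \<le> lev y}"
    then consider "lev x < lev y" | "lev y = lev x" by fastforce
    then show "y \<in> ?D"
    proof cases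
      case 1
      then show ?thesis using descendants_upper[OF kept_subset xD e] by simp
    next
      case 2
      then have "y \<noteq> s" using x(1) lev_sink lev_pos[OF w] by auto
      then have "y \<in> ?S"
        using 2 x(1) joins_in_verts[OF _ e(2)] e(1) kept_subset by (auto simp: nonsink_def)
      then show ?thesis by (rule descendants.base)
    qed
  qed
  finally have le: "edge_count kept x {y. lev y = lev x} + edge_count kept x {y. lev x < lev y}
      \<le> \<eta> x" using x(2) by simp
  have less: "\<eta> x < edge_count kept x UNIV"
    using x(1) \<eta> by (auto simp: allowed_def)
  have "x \<in> W"
    using le less edge_count_split3[OF kept_subset, of x lev] edge_count_lower[OF kept_subset, of x]
    by fastforce
  then have "x = w" by (rule inj_onD[OF lev_inj, rotated]) (use w x(1) in simp_all)
  then show ?thesis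
    using le less edge_count_split3[OF kept_subset, of w lev] edge_count_kept_lower[OF w]
      degree_kept_W[OF w] by simp
qed

text \<open>Take the part \<open>?S\<close> of \<open>F\<close> in its lowest level and a vertex of
  it that is burnable among the descendants of \<open>?S\<close>. Edges within a level are never
  removed, kept edges upwards lead to descendants, and removed edges upwards are covered by
  \<open>children\<close>.\<close>

lemma burnable_kept_imp_arcs:
  assumes \<eta>: "\<eta> \<in> allowed kept (nonsink G s)" and F: "F \<subseteq> nonsink G s" "F \<noteq> {}"
  shows "\<exists>x\<in>F. edge_count (arcs G) x F \<le> \<eta> x + children x"
proof -
  have "finite F" using F(1) finite_verts finite_subset by (fastforce simp: nonsink_def)
  define i where "i = Min (lev ` F)"
  have i: "i \<le> lev y" if "y \<in> F" for y using that \<open>finite F\<close> by (simp add: i_def)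
  have "i \<in> lev ` F" unfolding i_def using \<open>finite F\<close> F(2) by (intro Min_in) auto
  then obtain z where z: "z \<in> F" "lev z = i" by auto
  let ?S = "{x \<in> F. lev x = i}"
  let ?D = "descendants kept ?S"
  obtain x where x: "x \<in> ?S" "edge_count kept x ?D \<le> \<eta> x"
    using burnable_kept[OF \<eta>, of ?S] z F(1) by auto
  have xD: "x \<in> ?D" using x(1) by (rule descendants.base)
  have "edge_count (arcs G) x F = edge_count (arcs G) x (?S \<union> {y \<in> F. lev x < lev y})"
    by (rule arg_cong[where f = "edge_count (arcs G) x"]) (use x(1) i in force)
  also have "\<dots> = edge_count (arcs G) x ?S + edge_count (arcs G) x {y \<in> F. lev x < lev y}"
    by (rule edge_count_Un) (use x(1) in auto)
  also have "\<dots> \<le> edge_count (arcs G) x ?S + edge_count (arcs G) x {y. lev x < lev y}"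
    using edge_count_mono[of "arcs G" "{y \<in> F. lev x < lev y}" "{y. lev x < lev y}" x] by auto
  also have "edge_count (arcs G) x ?S = edge_count kept x ?S"
    using edge_count_removed_same[of x] x(1)
      edge_count_mono[OF removed_subset, of ?S "{y. lev y = lev x}" x]
    by (auto simp: edge_count_arcs)
  also have "edge_count kept x ?S + edge_count (arcs G) x {y. lev x < lev y} =
      edge_count kept x ?S + edge_count kept x (?D \<inter> {y. lev x < lev y}) + children x"
    using edge_count_descendants_upper[OF kept_subset subset_refl xD]
    by (simp add: edge_count_arcs children_def)
  also have "edge_count kept x ?S + edge_count kept x (?D \<inter> {y. lev x < lev y}) =
      edge_count kept x (?S \<union> (?D \<inter> {y. lev x < lev y}))"
    by (rule edge_count_Un[OF kept_subset, symmetric]) (use x(1) in auto)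
  also have "\<dots> \<le> edge_count kept x ?D"
    by (rule edge_count_mono[OF kept_subset]) (auto intro: descendants.base)
  also note x(2)
  finally show ?thesis using x(1) by auto
qed

text \<open>The two transfers of the burning test make the shift and its inverse well defined. The
  parameter \<xi> will be instantiated by a sandpile on all nonsink vertices, which is why it is
  restricted to \<open>W\<close> here.\<close>

theorem card_allowed_restrict:
  "card {\<eta> \<in> allowed (arcs G) (nonsink G s). restrict \<eta> W = restrict \<xi> W} =
    card (allowed kept (nonsink G s))"
proof -
  let ?V = "nonsink G s"
  let ?X = "{\<eta> \<in> allowed (arcs G) ?V. restrict \<eta> W = restrict \<xi> W}"
  have "bij_betw (\<lambda>\<eta>. \<lambda>x\<in>?V. \<eta> x - children x) ?X (allowed kept ?V)"
  proof (rule bij_betw_byWitness[where f' = "\<lambda>\<eta>. \<lambda>x\<in>?V. \<eta> x + children x"])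
    have X: "\<eta> \<in> allowed (arcs G) ?V" "\<And>w. w \<in> W \<Longrightarrow> \<eta> w = \<xi> w" if "\<eta> \<in> ?X" for \<eta>
      using that by (auto dest: fun_cong simp: restrict_def split: if_splits)
    \<comment> \<open>The test set \<open>{x}\<close> shows that the truncated subtraction loses
      nothing.\<close>
    have le: "children x \<le> \<eta> x" if "\<eta> \<in> ?X" "x \<in> ?V" for \<eta> x
      using burnable_arcs_imp_kept[OF X[OF that(1)], of "{x}"] that(2) by auto
    show "\<forall>\<eta>\<in>?X. (\<lambda>x\<in>?V. (\<lambda>x\<in>?V. \<eta> x - children x) x + children x) = \<eta>"
    proof
      fix \<eta> assume \<eta>: "\<eta> \<in> ?X"
      then have "\<eta> \<in> extensional ?V" by (auto simp: allowed_def PiE_def)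
      then show "(\<lambda>x\<in>?V. (\<lambda>x\<in>?V. \<eta> x - children x) x + children x) = \<eta>"
        using le[OF \<eta>] by (auto simp: fun_eq_iff extensional_def)
    qed
    show "\<forall>\<eta>\<in>allowed kept ?V. (\<lambda>x\<in>?V. (\<lambda>x\<in>?V. \<eta> x + children x) x - children x) = \<eta>"
      by (auto simp: fun_eq_iff allowed_def PiE_def extensional_def)
    show "(\<lambda>\<eta>. \<lambda>x\<in>?V. \<eta> x - children x) ` ?X \<subseteq> allowed kept ?V"
    proof (rule image_subsetI)
      fix \<eta> assume \<eta>: "\<eta> \<in> ?X"
      have "burnable kept ?V (\<lambda>x\<in>?V. \<eta> x - children x)"
        unfolding burnable_def
      proof (intro allI impI)
        fix F assume F: "F \<subseteq> ?V" "F \<noteq> {}"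
        then obtain x where "x \<in> F" "edge_count kept x F + children x \<le> \<eta> x"
          using burnable_arcs_imp_kept[OF X[OF \<eta>]] by blast
        then show "\<exists>x\<in>F. edge_count kept x F \<le> (\<lambda>x\<in>?V. \<eta> x - children x) x"
          using F by (intro bexI[of _ x]) auto
      qed
      moreover have "\<eta> x - children x < edge_count kept x UNIV" if "x \<in> ?V" for x
      proof (cases "x \<in> W")
        case True
        then show ?thesis using X(2)[OF \<eta> True] degree_kept_W[OF True] le[OF \<eta> that] by simp
      next
        case False
        have "\<eta> x < edge_count (arcs G) x UNIV"
          using X(1)[OF \<eta>] that by (auto simp: allowed_def)
        then show ?thesis using degree_kept_nonW[OF False] le[OF \<eta> that] by simp
      qed
      ultimately show "(\<lambda>x\<in>?V. \<eta> x - children x) \<in> allowed kept ?V"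
        by (auto simp: allowed_def)
    qed
    show "(\<lambda>\<eta>. \<lambda>x\<in>?V. \<eta> x + children x) ` allowed kept ?V \<subseteq> ?X"
    proof (rule image_subsetI)
      fix \<eta> assume \<eta>: "\<eta> \<in> allowed kept ?V"
      have "burnable (arcs G) ?V (\<lambda>x\<in>?V. \<eta> x + children x)"
        unfolding burnable_def
      proof (intro allI impI)
        fix F assume F: "F \<subseteq> ?V" "F \<noteq> {}"
        then obtain x where "x \<in> F" "edge_count (arcs G) x F \<le> \<eta> x + children x"
          using burnable_kept_imp_arcs[OF \<eta>] by blast
        then show "\<exists>x\<in>F. edge_count (arcs G) x F \<le> (\<lambda>x\<in>?V. \<eta> x + children x) x"
          using F by (intro bexI[of _ x]) auto
      qed
      moreover have "\<eta> x + children x < edge_count (arcs G) x UNIV" if "x \<in> ?V" for x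
      proof (cases "x \<in> W")
        case True
        then show ?thesis
          using allowed_kept_eq[OF \<eta> True] degree_eq[OF True] lower_neighbour[OF True] by simp
      next
        case False
        have "\<eta> x < edge_count kept x UNIV"
          using \<eta> that by (auto simp: allowed_def)
        then show ?thesis using degree_kept_nonW[OF False] by simp
      qed
      moreover have "restrict (\<lambda>x\<in>?V. \<eta> x + children x) W = restrict \<xi> W"
        using allowed_kept_eq[OF \<eta>] W_subset by (auto simp: fun_eq_iff restrict_def)
      ultimately show "(\<lambda>x\<in>?V. \<eta> x + children x) \<in> ?X"
        by (auto simp: allowed_def)
    qed
  qed
  then show ?thesis by (rule bij_betw_same_card)
qed

end

section \<open>Construction of the levels by burning\<close>

context sink_multigraph
begin

text \<open>
  \<open>B\<close> is a set of vertices that \<open>\<eta>\<close> lets burn, with the vertices outside \<open>W\<close> burnt first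
  whenever possible; \<open>i\<close> is the current level.
\<close>

definition partial_levels ::
    "'v set \<Rightarrow> ('v \<Rightarrow> nat) \<Rightarrow> 'v set \<Rightarrow> ('v \<Rightarrow> nat) \<Rightarrow> nat \<Rightarrow> bool" where
  "partial_levels W \<eta> B lev i \<longleftrightarrow>
    s \<in> B \<and> B \<subseteq> verts G \<and> lev s = 0 \<and> (\<forall>y\<in>B. lev y \<le> i) \<and>
    (\<forall>F\<subseteq>nonsink G s. F \<inter> B \<noteq> {} \<longrightarrow> (\<exists>x\<in>F \<inter> B. edge_count (arcs G) x F \<le> \<eta> x)) \<and>
    (\<forall>e\<in>arcs G. \<forall>x\<in>B. \<forall>y\<in>B. joins e x y \<longrightarrow> lev x < lev y \<longrightarrow> y \<in> W) \<and>
    inj_on lev (W \<inter> B) \<and>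
    (\<forall>w\<in>W \<inter> B. edge_count (arcs G) w UNIV = \<eta> w + edge_count (arcs G) w {y \<in> B. lev y < lev w} \<and>
      0 < edge_count (arcs G) w {y \<in> B. lev y < lev w}) \<and>
    (\<forall>e\<in>arcs G. \<forall>x\<in>nonsink G s - B - W. \<forall>y\<in>B. joins e x y \<longrightarrow> lev y = i)"

lemma partial_levels_sink:
  assumes "W \<subseteq> nonsink G s"
  shows "partial_levels W \<eta> {s} (\<lambda>_. 0) 0"
  unfolding partial_levels_def using sink_in_verts assms by (auto simp: nonsink_def inj_on_def)

lemma partial_levels_all:
  assumes "W \<subseteq> nonsink G s" "partial_levels W \<eta> (verts G) lev i"
  shows "level_structure G s W \<eta> lev"
proof -
  note inv = assms(2)[unfolded partial_levels_def]
  have WV: "W \<inter> verts G = W" using assms(1) by (auto simp: nonsink_def)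
  have eq: "edge_count (arcs G) w {y \<in> verts G. lev y < lev w} =
      edge_count (arcs G) w {y. lev y < lev w}" for w
    by (rule edge_count_cong_joins) (auto dest: joins_in_verts)
  show ?thesis
  proof unfold_locales
    fix e x y assume e: "e \<in> arcs G" "joins e x y" "lev x < lev y"
    moreover have "x \<in> verts G" "y \<in> verts G"
      using joins_in_verts e(1,2) joins_commute[of e x y] by blast+
    ultimately show "y \<in> W" using inv by blast
  qed (use inv WV eq assms(1) in \<open>auto\<close>)
qed

text \<open>With the maximal stable value, \<open>x\<close> burns as soon as one neighbour has
  burnt. By the last clause of \<open>partial_levels\<close> all burnt neighbours of
  \<open>x\<close> have level \<open>i\<close>, so placing \<open>x\<close> there creates no edge
  from \<open>x\<close> down to a lower level.\<close>

lemma partial_levels_extend_nonW: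
  assumes inv: "partial_levels W \<eta> B lev i"
    and x: "x \<in> nonsink G s - B - W" "Suc (\<eta> x) = edge_count (arcs G) x UNIV"
    and e: "e \<in> arcs G" "joins e x y" "y \<in> B"
  shows "partial_levels W \<eta> (insert x B) (lev(x := i)) i"
proof -
  let ?lev = "lev(x := i)"
  note inv' = inv[unfolded partial_levels_def]
  have same: "?lev z = lev z" if "z \<in> B" for z using that x(1) by auto
  have le: "?lev z \<le> i" if "z \<in> insert x B" for z using that inv' x(1) by auto
  have burn: "\<exists>z\<in>F \<inter> insert x B. edge_count (arcs G) z F \<le> \<eta> z"
    if F: "F \<subseteq> nonsink G s" "F \<inter> insert x B \<noteq> {}" for F
  proof (cases "F \<inter> B = {}")
    case True
    then have "x \<in> F" using F(2) by auto
    have "0 < edge_count (arcs G) x B" using e edge_count_pos_joins[OF subset_refl] by blast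
    moreover have "edge_count (arcs G) x (F \<union> B) \<le> edge_count (arcs G) x UNIV"
      by (rule edge_count_mono) auto
    ultimately have "edge_count (arcs G) x F \<le> \<eta> x"
      using x(2) edge_count_Un[OF subset_refl True, of x] by simp
    then show ?thesis using \<open>x \<in> F\<close> by auto
  next
    case False
    then obtain z where "z \<in> F \<inter> B" "edge_count (arcs G) z F \<le> \<eta> z" using inv' F(1) by metis
    then show ?thesis by auto
  qed
  have lower: "{z \<in> insert x B. ?lev z < ?lev w} = {z \<in> B. lev z < lev w}" if "w \<in> B" for w
  proof -
    have "lev w \<le> i" "w \<noteq> x" using that inv' x(1) by auto
    then show ?thesis using x(1) by auto
  qed
  have adj: "lev v = i" if "f \<in> arcs G" "joins f x v" "v \<in> B" for f v
    using inv' x(1) that by blast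
  have upper: "v \<in> W"
    if f: "f \<in> arcs G" "joins f u v" and uv: "u \<in> insert x B" "v \<in> insert x B" "?lev u < ?lev v" for f u v
  proof (cases "u = x")
    case True
    then show ?thesis using le[OF uv(2)] uv(3) by simp
  next
    case u: False
    show ?thesis
    proof (cases "v = x")
      case True
      have "joins f x u" using f(2) unfolding True by (rule iffD1[OF joins_commute])
      then have "lev u = i" using adj f(1) u uv(1) by blast
      then show ?thesis using uv(3) u True by simp
    next
      case False
      then show ?thesis using inv' f u uv same by (metis insertE)
    qed
  qed
  have inj: "inj_on ?lev (W \<inter> insert x B)"
  proof -
    have "W \<inter> insert x B = W \<inter> B" using x(1) by auto
    moreover have "inj_on ?lev (W \<inter> B) \<longleftrightarrow> inj_on lev (W \<inter> B)"
      by (rule inj_on_cong) (use same in auto)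
    ultimately show ?thesis using inv' by simp
  qed
  have bound: "?lev v = i"
    if f: "f \<in> arcs G" "u \<in> nonsink G s - insert x B - W" "v \<in> insert x B" "joins f u v" for f u v
  proof (cases "v = x")
    case False
    then have "lev v = i" using inv' f by blast
    then show ?thesis using False by simp
  qed simp
  show ?thesis
    unfolding partial_levels_def
  proof (intro conjI)
    show "s \<in> insert x B" "insert x B \<subseteq> verts G" using inv' x(1) by (auto simp: nonsink_def)
    show "?lev s = 0" using inv' same by simp
    show "\<forall>w\<in>W \<inter> insert x B. edge_count (arcs G) w UNIV =
        \<eta> w + edge_count (arcs G) w {y \<in> insert x B. ?lev y < ?lev w} \<and>
        0 < edge_count (arcs G) w {y \<in> insert x B. ?lev y < ?lev w}"
    proof
      fix w assume "w \<in> W \<inter> insert x B"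
      then have w: "w \<in> W \<inter> B" using x(1) by auto
      then have "w \<in> B" by simp
      show "edge_count (arcs G) w UNIV =
        \<eta> w + edge_count (arcs G) w {y \<in> insert x B. ?lev y < ?lev w} \<and>
        0 < edge_count (arcs G) w {y \<in> insert x B. ?lev y < ?lev w}"
        unfolding lower[OF \<open>w \<in> B\<close>] using inv' w by blast
    qed
    show "\<forall>y\<in>insert x B. ?lev y \<le> i" using le by (intro ballI)
    show "\<forall>F\<subseteq>nonsink G s. F \<inter> insert x B \<noteq> {} \<longrightarrow>
        (\<exists>z\<in>F \<inter> insert x B. edge_count (arcs G) z F \<le> \<eta> z)"
      using burn by (intro allI impI)
    show "\<forall>e\<in>arcs G. \<forall>u\<in>insert x B. \<forall>v\<in>insert x B.
        joins e u v \<longrightarrow> ?lev u < ?lev v \<longrightarrow> v \<in> W"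
      using upper by (intro ballI impI)
    show "inj_on ?lev (W \<inter> insert x B)" by (rule inj)
    show "\<forall>e\<in>arcs G. \<forall>u\<in>nonsink G s - insert x B - W. \<forall>v\<in>insert x B.
        joins e u v \<longrightarrow> ?lev v = i"
      using bound by (intro ballI impI)
  qed
qed

text \<open>By \<open>saturated\<close>, no unburnt vertex outside \<open>W\<close> touches
  \<open>B\<close>, so \<open>w\<close> can open a new level: afterwards \<open>w\<close> is the
  only burnt vertex that may be adjacent to such vertices, as the last clause of
  \<open>partial_levels\<close> demands.\<close>

lemma partial_levels_extend_W:
  assumes inv: "partial_levels W \<eta> B lev i"
    and \<eta>: "\<eta> \<in> allowed (arcs G) (nonsink G s)"
    and w: "w \<in> W" "w \<in> nonsink G s - B" "edge_count (arcs G) w (nonsink G s - B) \<le> \<eta> w"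
    and minimal: "\<eta> w = 0 \<or> \<eta>(w := \<eta> w - 1) \<notin> allowed (arcs G) (nonsink G s)"
    and saturated: "\<And>e x y. e \<in> arcs G \<Longrightarrow> x \<in> nonsink G s - B - W \<Longrightarrow> y \<in> B \<Longrightarrow> \<not> joins e x y"
  shows "partial_levels W \<eta> (insert w B) (lev(w := Suc i)) (Suc i)"
proof -
  let ?lev = "lev(w := Suc i)"
  note inv' = inv[unfolded partial_levels_def]
  have same: "?lev z = lev z" if "z \<in> B" for z using that w(2) by auto
  have le: "lev z \<le> i" if "z \<in> B" for z using that inv' by auto
  have burnB: "\<exists>z\<in>F \<inter> B. edge_count (arcs G) z F \<le> \<eta> z"
    if "F \<subseteq> nonsink G s" "F \<inter> B \<noteq> {}" for F
    using inv' that by blast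
  \<comment> \<open>With a particle to spare, \<open>w\<close> could lose one without failing the
    test: test sets meeting \<open>B\<close> have a burnable vertex in \<open>B\<close>, those
    disjoint from \<open>B\<close> and containing \<open>w\<close> have \<open>w\<close>, and in the
    others no value changes. This contradicts minimality.\<close>
  have exact: "edge_count (arcs G) w (nonsink G s - B) = \<eta> w"
  proof (rule ccontr)
    assume "\<not> ?thesis"
    then have less: "edge_count (arcs G) w (nonsink G s - B) < \<eta> w" using w(3) by simp
    have "burnable (arcs G) (nonsink G s) (\<eta>(w := \<eta> w - 1))"
      unfolding burnable_def
    proof (intro allI impI)
      fix F assume F: "F \<subseteq> nonsink G s" "F \<noteq> {}"
      consider "F \<inter> B \<noteq> {}" | "F \<inter> B = {}" "w \<in> F" | "w \<notin> F" by blast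
      then show "\<exists>x\<in>F. edge_count (arcs G) x F \<le> (\<eta>(w := \<eta> w - 1)) x"
      proof cases
        case 1
        then obtain z where "z \<in> F \<inter> B" "edge_count (arcs G) z F \<le> \<eta> z" using burnB F(1) by blast
        then show ?thesis using w(2) by (intro bexI[of _ z]) auto
      next
        case 2
        have "edge_count (arcs G) w F \<le> edge_count (arcs G) w (nonsink G s - B)"
          by (rule edge_count_mono) (use F 2 in auto)
        then show ?thesis using 2 less by (intro bexI[of _ w]) auto
      next
        case 3
        obtain z where "z \<in> F" "edge_count (arcs G) z F \<le> \<eta> z"
          using \<eta> F unfolding allowed_def burnable_def by blast
        then show ?thesis using 3 by (intro bexI[of _ z]) auto
      qed
    qed
    moreover have "\<eta>(w := \<eta> w - 1) \<in> nonsink G s \<rightarrow>\<^sub>E UNIV"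
      using \<eta> w(2) by (auto simp: allowed_def PiE_def extensional_def)
    moreover have "(\<eta>(w := \<eta> w - 1)) x < edge_count (arcs G) x UNIV" if "x \<in> nonsink G s" for x
    proof -
      have "\<eta> x < edge_count (arcs G) x UNIV" using \<eta> that by (auto simp: allowed_def)
      then show ?thesis by (cases "x = w") auto
    qed
    ultimately have "\<eta>(w := \<eta> w - 1) \<in> allowed (arcs G) (nonsink G s)"
      by (simp add: allowed_def)
    then show False using minimal less by simp
  qed
  have deg: "edge_count (arcs G) w UNIV = \<eta> w + edge_count (arcs G) w B"
  proof -
    have "edge_count (arcs G) w UNIV = edge_count (arcs G) w ((nonsink G s - B) \<union> B)"
    proof (rule edge_count_cong_joins)
      fix e y assume "e \<in> arcs G" "joins e w y"
      then have "y \<in> insert s (nonsink G s)" unfolding verts_eq[symmetric] by (rule joins_in_verts)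
      then show "y \<in> UNIV \<longleftrightarrow> y \<in> (nonsink G s - B) \<union> B" using inv' by blast
    qed
    also have "\<dots> = edge_count (arcs G) w (nonsink G s - B) + edge_count (arcs G) w B"
      by (rule edge_count_Un) auto
    finally show ?thesis using exact by simp
  qed
  have pos: "0 < edge_count (arcs G) w B"
  proof -
    have "\<eta> w < edge_count (arcs G) w UNIV" using \<eta> w(2) by (auto simp: allowed_def)
    then show ?thesis using deg by simp
  qed
  have lower: "{z \<in> insert w B. ?lev z < ?lev v} = (if v = w then B else {z \<in> B. lev z < lev v})"
    if "v \<in> insert w B" for v
  proof (cases "v = w")
    case True
    then show ?thesis using le w(2) by (auto simp: less_Suc_eq_le)
  next
    case False
    then have "v \<in> B" using that by simp
    then have "lev v < Suc i" using le by (simp add: less_Suc_eq_le)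
    then show ?thesis using False w(2) by auto
  qed
  have burn: "\<exists>z\<in>F \<inter> insert w B. edge_count (arcs G) z F \<le> \<eta> z"
    if F: "F \<subseteq> nonsink G s" "F \<inter> insert w B \<noteq> {}" for F
  proof (cases "F \<inter> B = {}")
    case True
    then have "w \<in> F" using F(2) by auto
    have "edge_count (arcs G) w F \<le> edge_count (arcs G) w (nonsink G s - B)"
      by (rule edge_count_mono) (use F True in auto)
    then show ?thesis using w(3) \<open>w \<in> F\<close> by auto
  next
    case False
    then show ?thesis using burnB[OF F(1)] by auto
  qed
  have upper: "v \<in> W"
    if f: "f \<in> arcs G" "joins f u v" and uv: "u \<in> insert w B" "v \<in> insert w B" "?lev u < ?lev v" for f u v
  proof (cases "v = w")
    case False
    then have v: "v \<in> B" using uv(2) by simp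
    then have "lev v \<le> i" by (rule le)
    then have "u \<noteq> w" using uv(3) False by auto
    then have "u \<in> B" "lev u < lev v" using uv False by auto
    then show ?thesis using inv' f v by blast
  qed (use w(1) in simp)
  have inj: "inj_on ?lev (W \<inter> insert w B)"
  proof -
    have "inj_on ?lev (W \<inter> B) \<longleftrightarrow> inj_on lev (W \<inter> B)"
      by (rule inj_on_cong) (use same in auto)
    then have "inj_on ?lev (W \<inter> B)" using inv' by simp
    moreover have "?lev w \<notin> ?lev ` (W \<inter> B - {w})"
    proof
      assume "?lev w \<in> ?lev ` (W \<inter> B - {w})"
      then obtain v where "v \<in> B" "v \<noteq> w" "Suc i = lev v" by auto
      then show False using le[of v] by simp
    qed
    moreover have "W \<inter> insert w B = insert w (W \<inter> B)" using w(1) by auto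
    ultimately show ?thesis by (simp only: inj_on_insert simp_thms)
  qed
  have bound: "?lev v = Suc i"
    if f: "f \<in> arcs G" "u \<in> nonsink G s - insert w B - W" "v \<in> insert w B" "joins f u v" for f u v
  proof (cases "v = w")
    case False
    then show ?thesis using saturated[of f u v] f by auto
  qed simp
  have le': "?lev v \<le> Suc i" if "v \<in> insert w B" for v
    using that le[of v] by (cases "v = w") auto
  show ?thesis
    unfolding partial_levels_def
  proof (intro conjI)
    show "s \<in> insert w B" "insert w B \<subseteq> verts G" using inv' w(2) by (auto simp: nonsink_def)
    show "?lev s = 0" using inv' same by simp
    show "\<forall>v\<in>W \<inter> insert w B. edge_count (arcs G) v UNIV =
        \<eta> v + edge_count (arcs G) v {y \<in> insert w B. ?lev y < ?lev v} \<and>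
        0 < edge_count (arcs G) v {y \<in> insert w B. ?lev y < ?lev v}"
    proof
      fix v assume v: "v \<in> W \<inter> insert w B"
      then have "v \<in> insert w B" by simp
      note l = lower[OF this]
      show "edge_count (arcs G) v UNIV =
        \<eta> v + edge_count (arcs G) v {y \<in> insert w B. ?lev y < ?lev v} \<and>
        0 < edge_count (arcs G) v {y \<in> insert w B. ?lev y < ?lev v}"
      proof (cases "v = w")
        case True
        show ?thesis unfolding l if_P[OF True] unfolding True using deg pos by blast
      next
        case False
        then have "v \<in> W \<inter> B" using v by blast
        then show ?thesis unfolding l if_not_P[OF False] using inv' by blast
      qed
    qed
    show "\<forall>y\<in>insert w B. ?lev y \<le> Suc i" using le' by (intro ballI)
    show "\<forall>F\<subseteq>nonsink G s. F \<inter> insert w B \<noteq> {} \<longrightarrow>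
        (\<exists>z\<in>F \<inter> insert w B. edge_count (arcs G) z F \<le> \<eta> z)"
      using burn by (intro allI impI)
    show "\<forall>e\<in>arcs G. \<forall>u\<in>insert w B. \<forall>v\<in>insert w B.
        joins e u v \<longrightarrow> ?lev u < ?lev v \<longrightarrow> v \<in> W"
      using upper by (intro ballI impI)
    show "inj_on ?lev (W \<inter> insert w B)" by (rule inj)
    show "\<forall>e\<in>arcs G. \<forall>u\<in>nonsink G s - insert w B - W. \<forall>v\<in>insert w B.
        joins e u v \<longrightarrow> ?lev v = Suc i"
      using bound by (intro ballI impI)
  qed
qed

text \<open>Take a maximal burnt set. If vertices were left, the burning test on them would give a
  burnable one. In \<open>W\<close> it extends the set; outside \<open>W\<close> it has no burnt
  neighbour and would have to carry at least its degree.\<close>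

theorem level_structure_exists:
  assumes W: "W \<subseteq> nonsink G s" and \<eta>: "\<eta> \<in> allowed (arcs G) (nonsink G s)"
    and max: "\<And>x. x \<in> nonsink G s - W \<Longrightarrow> Suc (\<eta> x) = edge_count (arcs G) x UNIV"
    and min: "\<And>w. w \<in> W \<Longrightarrow> \<eta> w = 0 \<or> \<eta>(w := \<eta> w - 1) \<notin> allowed (arcs G) (nonsink G s)"
  shows "\<exists>lev. level_structure G s W \<eta> lev"
proof -
  let ?P = "{B \<in> Pow (verts G). \<exists>lev i. partial_levels W \<eta> B lev i}"
  have "finite ?P" by simp
  moreover have "{s} \<in> ?P" using partial_levels_sink[OF W, of \<eta>] sink_in_verts by auto
  ultimately obtain B where B: "B \<in> ?P" and maximal: "\<And>B'. B' \<in> ?P \<Longrightarrow> B \<subseteq> B' \<Longrightarrow> B = B'"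
    using finite_has_maximal[of ?P] by (metis (no_types, lifting) emptyE)
  obtain lev i where inv: "partial_levels W \<eta> B lev i" using B by blast
  have sB: "s \<in> B" and BV: "B \<subseteq> verts G" using inv by (auto simp: partial_levels_def)
  have no_extend: False if "partial_levels W \<eta> (insert x B) lev' i'" "x \<in> nonsink G s - B" for x lev' i'
    using maximal[of "insert x B"] that BV verts_eq by auto
  have saturated: "\<not> joins e x y" if "e \<in> arcs G" "x \<in> nonsink G s - B - W" "y \<in> B" for e x y
    using partial_levels_extend_nonW[OF inv that(2) max that(1) _ that(3)] no_extend[of x] that(2) by blast
  have "nonsink G s - B = {}"
  proof (rule ccontr)
    assume "nonsink G s - B \<noteq> {}"
    then obtain x where x: "x \<in> nonsink G s - B" "edge_count (arcs G) x (nonsink G s - B) \<le> \<eta> x"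
      using \<eta> unfolding allowed_def burnable_def by blast
    show False
    proof (cases "x \<in> W")
      case True
      show False
        using partial_levels_extend_W[OF inv \<eta> True x min[OF True] saturated] no_extend[of x] x(1) by blast
    next
      case False
      have "edge_count (arcs G) x UNIV = edge_count (arcs G) x (nonsink G s - B)"
      proof (rule edge_count_cong_joins)
        fix e y assume e: "e \<in> arcs G" "joins e x y"
        then have "y \<notin> B" using saturated[of e x y] x(1) False by blast
        moreover have "y \<in> verts G" using e by (rule joins_in_verts)
        ultimately show "y \<in> UNIV \<longleftrightarrow> y \<in> nonsink G s - B" using sB verts_eq by auto
      qed
      moreover have "\<eta> x < edge_count (arcs G) x UNIV" using \<eta> x(1) by (auto simp: allowed_def)
      ultimately show False using x(2) by simp
    qed
  qed
  then have "B = verts G" using sB BV verts_eq by auto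
  then show ?thesis using partial_levels_all[OF W] inv by blast
qed

end

subsection \<open>Finite Markov chains\<close>

definition closed_states :: "('a \<Rightarrow> 'a pmf) \<Rightarrow> 'a set \<Rightarrow> bool" where
  "closed_states K X \<longleftrightarrow> (\<forall>z\<in>X. set_pmf (K z) \<subseteq> X)"

text \<open>The probability that the chain started at \<open>z\<close> stays away from
  \<open>y\<close> at the times 1 to \<open>n\<close>.\<close>

definition avoid_prob :: "('a \<Rightarrow> 'a pmf) \<Rightarrow> 'a \<Rightarrow> nat \<Rightarrow> 'a \<Rightarrow> real" where
  "avoid_prob K y n z = 1 - (\<Sum>i<n. first_passage K y i z)"

lemma expectation_finite_sum:
  assumes "finite (set_pmf p)"
  shows "measure_pmf.expectation p f = (\<Sum>z\<in>set_pmf p. f z * pmf p z)"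
  by (rule integral_measure_pmf_real[OF assms])

text \<open>First-step analysis: conditioning on the first transition gives a recursion that
  survives the limit.\<close>

lemma avoid_prob_Suc:
  assumes "finite (set_pmf (K z))"
  shows "avoid_prob K y (Suc n) z =
    measure_pmf.expectation (K z) (\<lambda>z'. if z' = y then 0 else avoid_prob K y n z')"
proof -
  let ?S = "set_pmf (K z)"
  have one: "(\<Sum>z'\<in>?S. pmf (K z) z') = 1"
    by (rule sum_pmf_eq_1[OF assms]) simp
  have y: "(\<Sum>z'\<in>?S. of_bool (z' = y) * pmf (K z) z') = pmf (K z) y"
  proof (cases "y \<in> ?S")
    case True
    then show ?thesis using assms by (subst sum.remove[of _ y]) (auto intro: sum.neutral)
  next
    case False
    then have "pmf (K z) y = 0" by (simp add: set_pmf_iff)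
    moreover have "(\<Sum>z'\<in>?S. of_bool (z' = y) * pmf (K z) z') = 0"
      by (rule sum.neutral) (use False in auto)
    ultimately show ?thesis by simp
  qed
  have "measure_pmf.expectation (K z) (\<lambda>z'. if z' = y then 0 else avoid_prob K y n z') =
      (\<Sum>z'\<in>?S. pmf (K z) z' - of_bool (z' = y) * pmf (K z) z' -
        (\<Sum>i<n. (if z' = y then 0 else first_passage K y i z') * pmf (K z) z'))"
    unfolding expectation_finite_sum[OF assms]
    by (rule sum.cong) (auto simp: avoid_prob_def algebra_simps sum_distrib_right sum_distrib_left)
  also have "\<dots> = 1 - pmf (K z) y -
      (\<Sum>i<n. \<Sum>z'\<in>?S. (if z' = y then 0 else first_passage K y i z') * pmf (K z) z')"
    unfolding sum_subtractf one y by (subst sum.swap) simp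
  also have "\<dots> = 1 - pmf (K z) y - (\<Sum>i<n. first_passage K y (Suc i) z)"
    by (simp add: expectation_finite_sum[OF assms])
  also have "\<dots> = avoid_prob K y (Suc n) z"
    unfolding avoid_prob_def by (subst sum.lessThan_Suc_shift) simp
  finally show ?thesis by simp
qed

lemma avoid_prob_bounds:
  assumes "\<And>z. finite (set_pmf (K z))"
  shows "0 \<le> avoid_prob K y n z" "avoid_prob K y (Suc n) z \<le> avoid_prob K y n z"
proof -
  have nn: "0 \<le> first_passage K y n z" for n z
    by (induction n arbitrary: z) (auto intro!: Bochner_Integration.integral_nonneg)
  then show "avoid_prob K y (Suc n) z \<le> avoid_prob K y n z"
    by (simp add: avoid_prob_def)
  show "0 \<le> avoid_prob K y n z"
  proof (induction n arbitrary: z)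
    case (Suc n)
    then show ?case
      unfolding avoid_prob_Suc[of K z y n, OF assms]
      by (auto intro!: Bochner_Integration.integral_nonneg)
  qed (simp add: avoid_prob_def)
qed

text \<open>The limit \<open>g z\<close> is the probability of never visiting \<open>y\<close> after
  time 0; it satisfies an averaging identity in which arrival at \<open>y\<close> counts as
  0.\<close>

lemma avoid_prob_limit:
  assumes fin: "\<And>z. finite (set_pmf (K z))"
  obtains g where "\<And>z. (\<lambda>n. avoid_prob K y n z) \<longlonglongrightarrow> g z" "\<And>z. 0 \<le> g z"
    "\<And>z. g z = (\<Sum>z'\<in>set_pmf (K z). (if z' = y then 0 else g z') * pmf (K z) z')"
proof -
  have dec: "decseq (\<lambda>n. avoid_prob K y n z)" for z
    using avoid_prob_bounds(2)[of K, OF fin] by (rule decseq_SucI)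
  have "\<exists>l. (\<lambda>n. avoid_prob K y n z) \<longlonglongrightarrow> l" for z
  proof -
    have "\<forall>n. 0 \<le> avoid_prob K y n z" using avoid_prob_bounds(1)[of K, OF fin] by blast
    then obtain l where "(\<lambda>n. avoid_prob K y n z) \<longlonglongrightarrow> l"
      by (rule decseq_convergent[OF dec])
    then show ?thesis by blast
  qed
  then obtain g where g: "\<And>z. (\<lambda>n. avoid_prob K y n z) \<longlonglongrightarrow> g z" by metis
  have "0 \<le> g z" for z
    by (rule LIMSEQ_le_const[OF g]) (use avoid_prob_bounds(1)[of K, OF fin] in auto)
  moreover have "g z = (\<Sum>z'\<in>set_pmf (K z). (if z' = y then 0 else g z') * pmf (K z) z')" for z
  proof (rule LIMSEQ_unique)
    show "(\<lambda>n. avoid_prob K y (Suc n) z) \<longlonglongrightarrow> g z" using g by (rule LIMSEQ_Suc)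
    show "(\<lambda>n. avoid_prob K y (Suc n) z) \<longlonglongrightarrow>
        (\<Sum>z'\<in>set_pmf (K z). (if z' = y then 0 else g z') * pmf (K z) z')"
      unfolding avoid_prob_Suc[of K z y, OF fin] expectation_finite_sum[OF fin]
      by (intro tendsto_sum tendsto_mult tendsto_const) (use g in auto)
  qed
  ultimately show thesis using that g by blast
qed

lemma recurrent_state_iff_avoid_prob:
  "recurrent_state K y \<longleftrightarrow> (\<lambda>n. avoid_prob K y n y) \<longlonglongrightarrow> 0"
proof
  assume "recurrent_state K y"
  then have "(\<lambda>n. \<Sum>i<n. first_passage K y i y) \<longlonglongrightarrow> 1"
    by (simp add: recurrent_state_def sums_def)
  then have "(\<lambda>n. 1 - (\<Sum>i<n. first_passage K y i y)) \<longlonglongrightarrow> 1 - 1"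
    by (intro tendsto_intros)
  then show "(\<lambda>n. avoid_prob K y n y) \<longlonglongrightarrow> 0" by (simp add: avoid_prob_def)
next
  assume "(\<lambda>n. avoid_prob K y n y) \<longlonglongrightarrow> 0"
  then have "(\<lambda>n. 1 - avoid_prob K y n y) \<longlonglongrightarrow> 1 - 0"
    by (intro tendsto_intros)
  then show "recurrent_state K y" by (simp add: recurrent_state_def sums_def avoid_prob_def)
qed

text \<open>Maximum principle for the limit \<open>g\<close> of the avoidance probabilities.\<close>

lemma recurrent_stateI:
  assumes fin: "\<And>z. finite (set_pmf (K z))" and A: "finite A" "closed_states K A" "y \<in> A"
    and irred: "\<And>X. X \<subseteq> A \<Longrightarrow> X \<noteq> {} \<Longrightarrow> closed_states K X \<Longrightarrow> y \<in> X"
  shows "recurrent_state K y"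
proof -
  obtain g where g: "\<And>z. (\<lambda>n. avoid_prob K y n z) \<longlonglongrightarrow> g z" and nn: "\<And>z. 0 \<le> g z"
    and harm: "\<And>z. g z = (\<Sum>z'\<in>set_pmf (K z). (if z' = y then 0 else g z') * pmf (K z) z')"
    using avoid_prob_limit[of K y, OF fin] by blast
  have "g y = 0"
  proof (rule ccontr)
    assume "g y \<noteq> 0"
    define M where "M = Max (g ` A)"
    have le: "g z \<le> M" if "z \<in> A" for z using that A(1) by (simp add: M_def)
    have "M > 0" using le[OF A(3)] nn[of y] \<open>g y \<noteq> 0\<close> by simp
    define X where "X = {z \<in> A. g z = M}"
    \<comment> \<open>A maximal value that is an average is attained at every successor, and
      \<open>y\<close>, which counts as 0, cannot be one. So \<open>X - {y}\<close> is closed,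
      against \<open>irred\<close>.\<close>
    have succ: "z' \<in> X \<and> z' \<noteq> y" if z: "z \<in> X" and z': "z' \<in> set_pmf (K z)" for z z'
    proof (rule ccontr)
      assume not: "\<not> (z' \<in> X \<and> z' \<noteq> y)"
      let ?f = "\<lambda>z'. if z' = y then 0 else g z'"
      have sub: "set_pmf (K z) \<subseteq> A" using z A(2) by (auto simp: X_def closed_states_def)
      have "(\<Sum>z'\<in>set_pmf (K z). ?f z' * pmf (K z) z') < (\<Sum>z'\<in>set_pmf (K z). M * pmf (K z) z')"
      proof (rule sum_strict_mono_ex1[OF fin])
        show "\<forall>u\<in>set_pmf (K z). ?f u * pmf (K z) u \<le> M * pmf (K z) u"
          using le sub \<open>M > 0\<close> by (auto intro!: mult_right_mono)
        have "?f z' < M" using not le[of z'] sub z' \<open>M > 0\<close> by (auto simp: X_def)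
        then show "\<exists>u\<in>set_pmf (K z). ?f u * pmf (K z) u < M * pmf (K z) u"
          using z' by (intro bexI[of _ z'] mult_strict_right_mono) (auto intro: pmf_positive)
      qed
      also have "\<dots> = M"
        using sum_pmf_eq_1[OF fin[of z] subset_refl] by (simp flip: sum_distrib_left)
      finally show False using harm[of z] z by (simp add: X_def)
    qed
    have "X \<noteq> {}"
    proof -
      have "M \<in> g ` A" unfolding M_def using A by (intro Max_in) auto
      then show ?thesis by (auto simp: X_def)
    qed
    then obtain z where "z \<in> X" by blast
    moreover obtain z' where "z' \<in> set_pmf (K z)" using set_pmf_not_empty[of "K z"] by blast
    ultimately have "X - {y} \<noteq> {}" using succ by blast
    moreover have "closed_states K (X - {y})" using succ by (auto simp: closed_states_def)
    ultimately show False using irred[of "X - {y}"] by (auto simp: X_def)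
  qed
  then show ?thesis using g[of y] by (simp add: recurrent_state_iff_avoid_prob)
qed

text \<open>From \<open>A\<close> the state \<open>y\<close> is never reached, so \<open>g\<close>
  equals 1 there. If \<open>y\<close> were recurrent, \<open>g\<close> would vanish at
  \<open>y\<close> and hence at all states reachable from it; the zeros of \<open>g\<close> in
  \<open>S\<close> would form a closed set containing \<open>y\<close> and missing
  \<open>A\<close>.\<close>

lemma not_recurrent_stateI:
  assumes fin: "\<And>z. finite (set_pmf (K z))" and A: "closed_states K A" "y \<notin> A"
    and S: "closed_states K S" "y \<in> S"
    and meets: "\<And>X. X \<subseteq> S \<Longrightarrow> y \<in> X \<Longrightarrow> closed_states K X \<Longrightarrow> X \<inter> A \<noteq> {}"
  shows "\<not> recurrent_state K y"
proof
  assume rec: "recurrent_state K y"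
  obtain g where g: "\<And>z. (\<lambda>n. avoid_prob K y n z) \<longlonglongrightarrow> g z" and nn: "\<And>z. 0 \<le> g z"
    and harm: "\<And>z. g z = (\<Sum>z'\<in>set_pmf (K z). (if z' = y then 0 else g z') * pmf (K z) z')"
    using avoid_prob_limit[of K y, OF fin] by blast
  have "g y = 0"
    using rec g[of y] LIMSEQ_unique unfolding recurrent_state_iff_avoid_prob by blast
  have passage: "first_passage K y n z = 0" if "z \<in> A" for n z
    using that
  proof (induction n arbitrary: z)
    case 0
    then have "y \<notin> set_pmf (K z)" using A by (auto simp: closed_states_def)
    then show ?case by (simp add: set_pmf_iff)
  next
    case (Suc n)
    then have "(if z' = y then 0 else first_passage K y n z') = 0" if "z' \<in> set_pmf (K z)" for z'
      using that A(1) by (auto simp: closed_states_def)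
    then have "(\<Sum>z'\<in>set_pmf (K z). (if z' = y then 0 else first_passage K y n z') * pmf (K z) z') = 0"
      by (intro sum.neutral) simp
    then show ?case by (simp add: expectation_finite_sum[OF fin])
  qed
  have gA: "g z = 1" if "z \<in> A" for z
  proof -
    have "avoid_prob K y n z = 1" for n
      using passage[OF that] by (simp add: avoid_prob_def)
    then show ?thesis using g[of z] by (simp add: LIMSEQ_const_iff)
  qed
  define X where "X = {z \<in> S. g z = 0}"
  have "closed_states K X"
    unfolding closed_states_def
  proof (intro ballI subsetI)
    fix z z' assume z: "z \<in> X" and z': "z' \<in> set_pmf (K z)"
    have "(\<Sum>z'\<in>set_pmf (K z). (if z' = y then 0 else g z') * pmf (K z) z') = 0"
      using harm[of z] z by (simp add: X_def)
    then have "(if z' = y then 0 else g z') * pmf (K z) z' = 0"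
      using z' nn by (subst (asm) sum_nonneg_eq_0_iff[OF fin]) auto
    then have "g z' = 0" using z' \<open>g y = 0\<close> by (auto simp: set_pmf_iff split: if_splits)
    then show "z' \<in> X" using z z' S(1) by (auto simp: X_def closed_states_def)
  qed
  then have "X \<inter> A \<noteq> {}" using meets[of X] S(2) \<open>g y = 0\<close> by (auto simp: X_def)
  then show False using gA by (auto simp: X_def)
qed

text \<open>Stationarity preserves the mass of \<open>A\<close>, and none leaves the closed set
  \<open>A\<close>, so none enters. The part of the support outside \<open>A\<close> is therefore
  closed, and by \<open>meets\<close> it is empty.\<close>

lemma stationary_support:
  assumes fin: "finite (set_pmf \<mu>)" and A: "closed_states K A" and stat: "bind_pmf \<mu> K = \<mu>"
    and meets: "\<And>X. X \<subseteq> set_pmf \<mu> \<Longrightarrow> X \<noteq> {} \<Longrightarrow> closed_states K X \<Longrightarrow> X \<inter> A \<noteq> {}"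
  shows "set_pmf \<mu> \<subseteq> A"
proof -
  let ?S = "set_pmf \<mu>"
  have closed: "set_pmf (K z) \<subseteq> ?S" if "z \<in> ?S" for z
    using that set_bind_pmf[of \<mu> K] unfolding stat by blast
  have bal: "pmf \<mu> y = (\<Sum>z\<in>?S. pmf (K z) y * pmf \<mu> z)" for y
    using pmf_bind[of \<mu> K y] unfolding stat expectation_finite_sum[OF fin] .
  define p where "p z = (\<Sum>y\<in>?S \<inter> A. pmf (K z) y)" for z
  have pA: "p z = 1" if "z \<in> ?S \<inter> A" for z
    unfolding p_def by (rule sum_pmf_eq_1) (use that closed A fin in \<open>auto simp: closed_states_def\<close>)
  have "(\<Sum>y\<in>?S \<inter> A. pmf \<mu> y) = (\<Sum>z\<in>?S. p z * pmf \<mu> z)"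
    unfolding p_def sum_distrib_right by (subst sum.swap) (rule sum.cong[OF refl bal])
  also have "\<dots> = (\<Sum>z\<in>?S \<inter> A. p z * pmf \<mu> z) + (\<Sum>z\<in>?S - A. p z * pmf \<mu> z)"
    by (subst sum.union_disjoint[symmetric]) (use fin in \<open>auto intro!: sum.cong\<close>)
  also have "(\<Sum>z\<in>?S \<inter> A. p z * pmf \<mu> z) = (\<Sum>y\<in>?S \<inter> A. pmf \<mu> y)"
    by (rule sum.cong) (use pA in auto)
  finally have "(\<Sum>z\<in>?S - A. p z * pmf \<mu> z) = 0" by simp
  then have zero: "p z * pmf \<mu> z = 0" if "z \<in> ?S - A" for z
    using that fin by (subst (asm) sum_nonneg_eq_0_iff) (auto simp: p_def intro!: sum_nonneg mult_nonneg_nonneg)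
  have "closed_states K (?S - A)"
    unfolding closed_states_def
  proof (intro ballI subsetI)
    fix z y assume z: "z \<in> ?S - A" and y: "y \<in> set_pmf (K z)"
    have "p z = 0" using zero[OF z] z by (auto simp: set_pmf_iff)
    then have "pmf (K z) u = 0" if "u \<in> ?S \<inter> A" for u
      using that fin unfolding p_def by (subst (asm) sum_nonneg_eq_0_iff) auto
    then show "y \<in> ?S - A" using y z closed[of z] by (auto simp: set_pmf_iff)
  qed
  then have "?S - A = {}" using meets[of "?S - A"] by blast
  then show ?thesis by blast
qed

text \<open>
  Subtracting from \<open>\<mu>\<close> the largest possible multiple of the uniform distribution leaves an
  invariant measure, whose support is closed but is not all of \<open>A\<close>.
\<close>

lemma stationary_unique:
  assumes A: "finite A" "A \<noteq> {}"
    and unif: "bind_pmf (pmf_of_set A) K = pmf_of_set A"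
    and irred: "\<And>X. X \<subseteq> A \<Longrightarrow> X \<noteq> {} \<Longrightarrow> closed_states K X \<Longrightarrow> X = A"
    and stat: "bind_pmf \<mu> K = \<mu>" and supp: "set_pmf \<mu> \<subseteq> A"
  shows "\<mu> = pmf_of_set A"
proof -
  have bal: "pmf \<mu> y = (\<Sum>z\<in>A. pmf (K z) y * pmf \<mu> z)" for y
    using pmf_bind[of \<mu> K y] integral_measure_pmf_real[OF A(1), of \<mu> "\<lambda>z. pmf (K z) y"] supp
    unfolding stat by auto
  have one: "(\<Sum>z\<in>A. pmf (K z) y) = 1" if "y \<in> A" for y
  proof -
    have "pmf (pmf_of_set A) y = (\<Sum>z\<in>A. pmf (K z) y) / real (card A)"
      using pmf_bind_pmf_of_set[OF A(2,1), of K y] unfolding unif by simp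
    then show ?thesis using A that by (simp add: field_simps)
  qed
  have closed: "set_pmf (K z) \<subseteq> A" if "z \<in> A" for z
    using that set_bind_pmf[of "pmf_of_set A" K] A unfolding unif by auto
  define t where "t = Min (pmf \<mu> ` A)"
  have t_le: "t \<le> pmf \<mu> z" if "z \<in> A" for z using that A by (simp add: t_def)
  have "t \<in> pmf \<mu> ` A" unfolding t_def using A by (intro Min_in) auto
  then obtain y0 where y0: "y0 \<in> A" "pmf \<mu> y0 = t" by blast
  define X where "X = {z \<in> A. t < pmf \<mu> z}"
  have "closed_states K X"
    unfolding closed_states_def
  proof (intro ballI subsetI)
    fix z y assume z: "z \<in> X" and y: "y \<in> set_pmf (K z)"
    have zA: "z \<in> A" and yA: "y \<in> A" using z y closed[of z] by (auto simp: X_def)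
    have "0 < pmf (K z) y * (pmf \<mu> z - t)"
      using z y by (auto simp: X_def intro!: mult_pos_pos pmf_positive)
    also have "\<dots> \<le> (\<Sum>u\<in>A. pmf (K u) y * (pmf \<mu> u - t))"
      by (rule member_le_sum) (use zA A t_le in auto)
    also have "\<dots> = pmf \<mu> y - t"
      using bal[of y] one[OF yA] by (simp add: right_diff_distrib sum_subtractf flip: sum_distrib_right)
    finally show "y \<in> X" using yA by (simp add: X_def)
  qed
  moreover have "X \<noteq> A" using y0 by (auto simp: X_def)
  ultimately have "X = {}" using irred[of X] by (auto simp: X_def)
  then have const: "pmf \<mu> z = t" if "z \<in> A" for z
    using t_le[OF that] that by (auto simp: X_def not_less intro: antisym)
  have "real (card A) * t = 1"
    using sum_pmf_eq_1[OF A(1) supp] const by simp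
  then have t: "t = 1 / real (card A)" using A by (simp add: field_simps)
  show ?thesis
  proof (rule pmf_eqI)
    fix z
    show "pmf \<mu> z = pmf (pmf_of_set A) z"
    proof (cases "z \<in> A")
      case True
      then show ?thesis using const t A by simp
    next
      case False
      then have "pmf \<mu> z = 0" using supp by (auto simp: set_pmf_iff)
      then show ?thesis using False A by simp
    qed
  qed
qed

subsection \<open>Stabilization\<close>

context sink_multigraph
begin

lemma finite_nonsink [simp]: "finite (nonsink G s)"
  by (simp add: nonsink_def)

lemma deg_eq: "deg G x = edge_count (arcs G) x UNIV"
proof -
  have "{e \<in> arcs G. tail G e = x \<and> head G e \<in> UNIV \<or> head G e = x \<and> tail G e \<in> UNIV} =
      in_arcs G x \<union> out_arcs G x"
    by (auto simp: in_arcs_def out_arcs_def)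
  moreover have "in_arcs G x \<inter> out_arcs G x = {}"
    using no_loops by (fastforce simp: in_arcs_def out_arcs_def)
  ultimately show ?thesis
    using card_Un_disjoint[OF finite_in_arcs finite_out_arcs, of x x]
    unfolding deg_def in_degree_def out_degree_def edge_count_def by simp
qed

lemma edge_mult_eq: "edge_mult G x y = edge_count (arcs G) y {x}"
  unfolding edge_mult_def edge_count_def
  by (rule arg_cong[where f = card]) (auto simp: doubleton_eq_iff)

definition topple :: "'v \<Rightarrow> ('v \<Rightarrow> nat) \<Rightarrow> 'v \<Rightarrow> nat" where
  "topple x \<eta> = (\<lambda>y \<in> nonsink G s.
    (if y = x then \<eta> y - edge_count (arcs G) x UNIV else \<eta> y) + edge_count (arcs G) y {x})"

lemma topples_iff:
  "topples G s \<eta> \<zeta> \<longleftrightarrow>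
    (\<exists>x\<in>nonsink G s. edge_count (arcs G) x UNIV \<le> \<eta> x \<and> \<zeta> = topple x \<eta>)"
  unfolding topples.simps[of G s \<eta> \<zeta>] deg_eq edge_mult_eq topple_def by blast

lemma stable_on_iff:
  "stable_on G (nonsink G s) \<eta> \<longleftrightarrow>
    \<eta> \<in> extensional (nonsink G s) \<and> (\<forall>x\<in>nonsink G s. \<eta> x < edge_count (arcs G) x UNIV)"
  by (auto simp: stable_on_def deg_eq PiE_def)

lemma allowed_iff:
  "\<eta> \<in> allowed (arcs G) (nonsink G s) \<longleftrightarrow>
    stable_on G (nonsink G s) \<eta> \<and> burnable (arcs G) (nonsink G s) \<eta>"
  by (auto simp: allowed_def stable_on_iff PiE_def)

lemma stable_not_topples:
  assumes "stable_on G (nonsink G s) \<eta>"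
  shows "\<not> topples G s \<eta> \<zeta>"
  using assms by (auto simp: topples_iff stable_on_iff not_le[symmetric])

lemma topple_self: "topple x \<eta> x = \<eta> x - edge_count (arcs G) x UNIV" if "x \<in> nonsink G s"
  using that by (simp add: topple_def edge_count_self)

lemma topple_other:
  "topple x \<eta> y = \<eta> y + edge_count (arcs G) y {x}" if "y \<in> nonsink G s" "y \<noteq> x"
  using that by (simp add: topple_def)

lemma topple_commute:
  assumes "x \<in> nonsink G s" "y \<in> nonsink G s" "x \<noteq> y"
    "edge_count (arcs G) x UNIV \<le> \<eta> x" "edge_count (arcs G) y UNIV \<le> \<eta> y"
  shows "topple y (topple x \<eta>) = topple x (topple y \<eta>)"
proof
  fix z
  consider "z \<notin> nonsink G s" | "z = x" | "z = y" | "z \<in> nonsink G s" "z \<noteq> x" "z \<noteq> y" by blast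
  then show "topple y (topple x \<eta>) z = topple x (topple y \<eta>) z"
  proof cases
    case 1
    then show ?thesis by (simp add: topple_def)
  qed (use assms in \<open>simp_all add: topple_self topple_other\<close>)
qed

text \<open>Legal topplings at two distinct vertices commute and stay legal, since each only adds
  particles at the other vertex.\<close>

lemma topples_confluent: "confluentp (topples G s)"
proof (rule strong_confluentp_imp_confluentp, rule strong_confluentpI)
  fix \<eta> a b assume "topples G s \<eta> a" "topples G s \<eta> b"
  then obtain x y where x: "x \<in> nonsink G s" "edge_count (arcs G) x UNIV \<le> \<eta> x" "a = topple x \<eta>"
    and y: "y \<in> nonsink G s" "edge_count (arcs G) y UNIV \<le> \<eta> y" "b = topple y \<eta>"
    unfolding topples_iff by blast
  show "\<exists>u. (topples G s)\<^sup>*\<^sup>* a u \<and> (topples G s)\<^sup>=\<^sup>= b u"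
  proof (cases "x = y")
    case True
    then show ?thesis using x y by auto
  next
    case False
    have "topples G s a (topple y a)" "topples G s b (topple x b)"
      unfolding topples_iff using x y False by (auto simp: topple_other intro!: bexI)
    moreover have "topple y a = topple x b"
      unfolding x(3) y(3) by (rule topple_commute[OF x(1) y(1) False x(2) y(2)])
    ultimately show ?thesis by auto
  qed
qed

lemma stable_normal_form:
  assumes "stable_on G (nonsink G s) \<eta>" "(topples G s)\<^sup>*\<^sup>* \<eta> \<zeta>"
  shows "\<zeta> = \<eta>"
  using assms(2) by (cases rule: converse_rtranclpE) (use assms(1) stable_not_topples in auto)

lemma stable_unique:
  assumes "(topples G s)\<^sup>*\<^sup>* \<eta> \<zeta>" "stable_on G (nonsink G s) \<zeta>"
    and "(topples G s)\<^sup>*\<^sup>* \<eta> \<zeta>'" "stable_on G (nonsink G s) \<zeta>'"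
  shows "\<zeta> = \<zeta>'"
proof -
  obtain u where "(topples G s)\<^sup>*\<^sup>* \<zeta> u" "(topples G s)\<^sup>*\<^sup>* \<zeta>' u"
    using confluentpD[OF topples_confluent assms(1,3)] by blast
  then show ?thesis using stable_normal_form assms(2,4) by metis
qed

lemma stabilization_eqI:
  assumes "(topples G s)\<^sup>*\<^sup>* \<eta> \<zeta>" "stable_on G (nonsink G s) \<zeta>"
  shows "stabilization G s \<eta> = \<zeta>"
  unfolding stabilization_def
proof (rule the_equality)
  show "(topples G s)\<^sup>*\<^sup>* \<eta> \<zeta> \<and> stable_on G (nonsink G s) \<zeta>" using assms by simp
next
  fix \<zeta>' assume "(topples G s)\<^sup>*\<^sup>* \<eta> \<zeta>' \<and> stable_on G (nonsink G s) \<zeta>'"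
  then show "\<zeta>' = \<zeta>" using stable_unique[OF _ _ assms] by blast
qed

text \<open>Connectedness enters here: a walk from a vertex of \<open>F\<close> to the sink has to
  leave \<open>F\<close>.\<close>

lemma edge_leaving:
  assumes "F \<subseteq> nonsink G s" "F \<noteq> {}"
  obtains e x y where "e \<in> arcs G" "joins e x y" "x \<in> F" "y \<notin> F"
proof -
  obtain u where u: "u \<in> F" using assms(2) by blast
  then have "u \<in> verts G" using assms(1) by (auto simp: nonsink_def)
  then have "(u, s) \<in> rtrancl_on (verts G) (parcs (mk_symmetric G))"
    using connected sink_in_verts
    by (auto simp: Digraph_Component.connected_def strongly_connected_def reachable_def)
  then have "s \<notin> F \<longrightarrow> (\<exists>e\<in>arcs G. \<exists>x\<in>F. \<exists>y. y \<notin> F \<and> joins e x y)"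
  proof (induction rule: rtrancl_on_induct)
    case base
    then show ?case using u by simp
  next
    case (step y z)
    show ?case
    proof (cases "y \<in> F \<and> z \<notin> F")
      case True
      obtain e where "e \<in> arcs G" "joins e y z"
        using step(2) by (auto simp: parcs_mk_symmetric joins_def)
      then show ?thesis using True by blast
    next
      case False
      then show ?thesis using step(5) by blast
    qed
  qed
  moreover have "s \<notin> F" using assms(1) by (auto simp: nonsink_def)
  ultimately show thesis using that by blast
qed

section \<open>The maximal stable sandpile and invertibility of the Laplacian\<close>

definition max_stable :: "'v \<Rightarrow> nat" where
  "max_stable = (\<lambda>x \<in> nonsink G s. edge_count (arcs G) x UNIV - 1)"

lemma degree_pos:
  assumes "x \<in> nonsink G s"
  shows "0 < edge_count (arcs G) x UNIV"
proof -
  obtain e u y where e: "e \<in> arcs G" "joins e u y" "u \<in> {x}" "y \<notin> {x}"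
    by (rule edge_leaving[of "{x}"]) (use assms in auto)
  then show ?thesis using edge_count_pos_joins[OF subset_refl, of x UNIV] by auto
qed

lemma max_stable_allowed: "max_stable \<in> allowed (arcs G) (nonsink G s)"
  unfolding allowed_iff
proof
  show "stable_on G (nonsink G s) max_stable"
    using degree_pos by (auto simp: stable_on_iff max_stable_def)
  show "burnable (arcs G) (nonsink G s) max_stable"
    unfolding burnable_def
  proof (intro allI impI)
    fix F assume F: "F \<subseteq> nonsink G s" "F \<noteq> {}"
    obtain e x y where e: "e \<in> arcs G" "joins e x y" "x \<in> F" "y \<notin> F"
      by (rule edge_leaving[OF F])
    then have "0 < edge_count (arcs G) x (- F)"
      using edge_count_pos_joins[OF subset_refl, of x "- F"] by blast
    moreover have "edge_count (arcs G) x UNIV = edge_count (arcs G) x F + edge_count (arcs G) x (- F)"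
      using edge_count_Un[OF subset_refl, of F "- F" x] by simp
    ultimately have "edge_count (arcs G) x F \<le> max_stable x"
      using F(1) e(3) by (auto simp: max_stable_def)
    then show "\<exists>x\<in>F. edge_count (arcs G) x F \<le> max_stable x" using e(3) by blast
  qed
qed

text \<open>The determinant counts the allowed sandpiles, and \<open>max_stable\<close> is one of
  them. No toppling is involved, so the result can serve to prove termination.\<close>

lemma det_laplacian_nonzero: "det_on (nonsink G s) (laplacian (arcs G)) \<noteq> 0"
proof -
  have "card (allowed (arcs G) (nonsink G s)) \<noteq> 0"
    using finite_allowed[OF finite_nonsink] max_stable_allowed by auto
  then show ?thesis
    using card_allowed[OF subset_refl finite_nonsink] by (metis of_nat_eq_0_iff)
qed

text \<open>
  Toppling any vertex decreases the total weight of the particles by \<open>1\<close> if a particle at \<open>x\<close>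
  has weight \<open>\<phi> x\<close>, where \<open>\<phi>\<close> solves the equation below. Hence every sandpile stabilizes.
\<close>

lemma laplacian_eq_one:
  obtains \<phi> where "\<And>x. x \<in> nonsink G s \<Longrightarrow> (\<Sum>y\<in>nonsink G s. laplacian (arcs G) x y * \<phi> y) = 1"
    "\<And>x. x \<in> nonsink G s \<Longrightarrow> 0 \<le> \<phi> x"
proof -
  let ?V = "nonsink G s" and ?L = "laplacian (arcs G)"
  obtain N where N: "\<And>x z. x \<in> ?V \<Longrightarrow> z \<in> ?V \<Longrightarrow> (\<Sum>y\<in>?V. ?L x y * N y z) = of_bool (x = z)"
    using det_on_nonzero_inverse[OF finite_nonsink det_laplacian_nonzero] by blast
  define \<phi> where "\<phi> y = (\<Sum>z\<in>?V. N y z)" for y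
  have eq: "(\<Sum>y\<in>?V. ?L x y * \<phi> y) = 1" if "x \<in> ?V" for x
  proof -
    have "(\<Sum>y\<in>?V. ?L x y * \<phi> y) = (\<Sum>z\<in>?V. \<Sum>y\<in>?V. ?L x y * N y z)"
      unfolding \<phi>_def sum_distrib_left by (rule sum.swap)
    also have "\<dots> = (\<Sum>z\<in>?V. of_bool (x = z))" using N that by simp
    also have "\<dots> = 1" using that by (subst sum.remove[of _ x]) (auto intro: sum.neutral)
    finally show ?thesis .
  qed
  \<comment> \<open>Minimum principle: at a vertex where \<phi> attains a negative minimum
    \<open>m\<close>, the signs of the off-diagonal entries and of the row sum make the left side of
    the equation nonpositive, but it is 1.\<close>
  have "0 \<le> \<phi> x" if x: "x \<in> ?V" for x
  proof (rule ccontr)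
    assume neg: "\<not> 0 \<le> \<phi> x"
    define m where "m = Min (\<phi> ` ?V)"
    have le: "m \<le> \<phi> y" if "y \<in> ?V" for y using that by (simp add: m_def)
    have "m \<in> \<phi> ` ?V" unfolding m_def using x by (intro Min_in) auto
    then obtain u where u: "u \<in> ?V" "\<phi> u = m" by auto
    have "(\<Sum>y\<in>?V. ?L u y * \<phi> y) = (\<Sum>y\<in>?V. ?L u y * (\<phi> y - m)) + m * (\<Sum>y\<in>?V. ?L u y)"
      by (simp add: algebra_simps sum_subtractf sum_distrib_left)
    moreover have "(\<Sum>y\<in>?V. ?L u y * (\<phi> y - m)) \<le> 0"
    proof (rule sum_nonpos)
      fix y assume "y \<in> ?V"
      then show "?L u y * (\<phi> y - m) \<le> 0"
        using le[of y] u(2) by (cases "y = u") (auto simp: laplacian_def mult_nonneg_nonneg)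
    qed
    moreover have "m * (\<Sum>y\<in>?V. ?L u y) \<le> 0"
      unfolding laplacian_row_sum[OF subset_refl finite_nonsink u(1)]
      using le[OF x] neg by (intro mult_nonpos_nonneg) auto
    ultimately show False using eq[OF u(1)] by simp
  qed
  then show thesis using that eq by blast
qed

lemma topple_laplacian:
  assumes "x \<in> nonsink G s" "y \<in> nonsink G s" "edge_count (arcs G) x UNIV \<le> \<eta> x"
  shows "real (topple x \<eta> y) = real (\<eta> y) - laplacian (arcs G) x y"
proof (cases "y = x")
  case True
  then show ?thesis using assms by (simp add: topple_self laplacian_def)
next
  case False
  then show ?thesis
    using assms edge_count_sym[of "arcs G" y x] by (simp add: topple_other laplacian_def)
qed

lemma topple_extensional: "topple x \<eta> \<in> extensional (nonsink G s)"
  by (simp add: topple_def)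

lemma stabilizes:
  assumes "\<eta> \<in> extensional (nonsink G s)"
  shows "\<exists>\<zeta>. (topples G s)\<^sup>*\<^sup>* \<eta> \<zeta> \<and> stable_on G (nonsink G s) \<zeta>"
proof -
  let ?V = "nonsink G s" and ?L = "laplacian (arcs G)"
  obtain \<phi> where eq: "\<And>x. x \<in> ?V \<Longrightarrow> (\<Sum>y\<in>?V. ?L x y * \<phi> y) = 1"
    and nn: "\<And>x. x \<in> ?V \<Longrightarrow> 0 \<le> \<phi> x"
    using laplacian_eq_one by blast
  define weight where "weight \<eta> = (\<Sum>y\<in>?V. real (\<eta> y) * \<phi> y)" for \<eta>
  have weight_nn: "0 \<le> weight \<eta>" for \<eta>
    unfolding weight_def by (intro sum_nonneg mult_nonneg_nonneg) (auto simp: nn)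
  have weight_topple: "weight (topple x \<eta>) = weight \<eta> - 1"
    if "x \<in> ?V" "edge_count (arcs G) x UNIV \<le> \<eta> x" for x \<eta>
  proof -
    have "weight (topple x \<eta>) = (\<Sum>y\<in>?V. real (\<eta> y) * \<phi> y - ?L x y * \<phi> y)"
      unfolding weight_def
      by (rule sum.cong) (use topple_laplacian that in \<open>auto simp: left_diff_distrib\<close>)
    then show ?thesis using eq[OF that(1)] by (simp add: sum_subtractf weight_def)
  qed
  have "\<exists>\<zeta>. (topples G s)\<^sup>*\<^sup>* \<eta> \<zeta> \<and> stable_on G ?V \<zeta>"
    if "\<eta> \<in> extensional ?V" "weight \<eta> < real n" for n \<eta>
    using that
  proof (induction n arbitrary: \<eta>)
    case 0
    then show ?case using weight_nn[of \<eta>] by simp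
  next
    case (Suc n)
    show ?case
    proof (cases "stable_on G ?V \<eta>")
      case False
      then obtain x where x: "x \<in> ?V" "edge_count (arcs G) x UNIV \<le> \<eta> x"
        using Suc.prems(1) by (auto simp: stable_on_iff not_less)
      have "weight (topple x \<eta>) < real n"
        using weight_topple[of x \<eta>, OF x] Suc.prems(2) by simp
      then obtain \<zeta> where \<zeta>: "(topples G s)\<^sup>*\<^sup>* (topple x \<eta>) \<zeta>" "stable_on G ?V \<zeta>"
        using Suc.IH[OF topple_extensional] by blast
      moreover have "topples G s \<eta> (topple x \<eta>)" using x by (auto simp: topples_iff)
      ultimately show ?thesis by (meson converse_rtranclp_into_rtranclp)
    qed auto
  qed
  then show ?thesis using assms reals_Archimedean2 by blast
qed

lemma stabilization:
  assumes "\<eta> \<in> extensional (nonsink G s)"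
  shows "(topples G s)\<^sup>*\<^sup>* \<eta> (stabilization G s \<eta>)" "stable_on G (nonsink G s) (stabilization G s \<eta>)"
proof -
  obtain \<zeta> where "(topples G s)\<^sup>*\<^sup>* \<eta> \<zeta>" "stable_on G (nonsink G s) \<zeta>"
    using stabilizes[OF assms] by blast
  then show "(topples G s)\<^sup>*\<^sup>* \<eta> (stabilization G s \<eta>)"
    "stable_on G (nonsink G s) (stabilization G s \<eta>)"
    using stabilization_eqI by simp_all
qed

text \<open>Every vertex other than \<open>x\<close> gains one particle per edge to
  \<open>x\<close>, which is exactly what putting \<open>x\<close> into the test set costs. So it
  suffices to test \<open>F - {x}\<close>.\<close>

lemma burnable_topple:
  assumes "burnable (arcs G) (nonsink G s) \<eta>"
  shows "burnable (arcs G) (nonsink G s) (topple x \<eta>)"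
  unfolding burnable_def
proof (intro allI impI)
  fix F assume F: "F \<subseteq> nonsink G s" "F \<noteq> {}"
  show "\<exists>z\<in>F. edge_count (arcs G) z F \<le> topple x \<eta> z"
  proof (cases "F = {x}")
    case True
    then show ?thesis by (simp add: edge_count_self)
  next
    case False
    then have "F - {x} \<subseteq> nonsink G s" "F - {x} \<noteq> {}" using F by auto
    then obtain z where z: "z \<in> F - {x}" "edge_count (arcs G) z (F - {x}) \<le> \<eta> z"
      using assms unfolding burnable_def by blast
    have "edge_count (arcs G) z F \<le> edge_count (arcs G) z ((F - {x}) \<union> {x})"
      by (rule edge_count_mono) auto
    also have "\<dots> = edge_count (arcs G) z (F - {x}) + edge_count (arcs G) z {x}"
      by (rule edge_count_Un) auto
    also have "\<dots> \<le> topple x \<eta> z"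
      using z F(1) topple_other[of z x \<eta>] by auto
    finally show ?thesis using z(1) by blast
  qed
qed

lemma burnable_topples:
  assumes "(topples G s)\<^sup>*\<^sup>* \<eta> \<zeta>" "burnable (arcs G) (nonsink G s) \<eta>"
  shows "burnable (arcs G) (nonsink G s) \<zeta>"
  using assms
proof (induction rule: rtranclp_induct)
  case (step y z)
  then show ?case unfolding topples_iff using burnable_topple by blast
qed

section \<open>Adding particles to sandpiles and to toppling sequences\<close>

definition padd :: "('v \<Rightarrow> nat) \<Rightarrow> ('v \<Rightarrow> nat) \<Rightarrow> 'v \<Rightarrow> nat" where
  "padd \<eta> \<gamma> = (\<lambda>y \<in> nonsink G s. \<eta> y + \<gamma> y)"

lemma padd_extensional: "padd \<eta> \<gamma> \<in> extensional (nonsink G s)"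
  by (simp add: padd_def)

lemma padd_assoc: "padd (padd \<eta> \<gamma>) \<delta> = padd \<eta> (padd \<gamma> \<delta>)"
  by (auto simp: padd_def fun_eq_iff)

lemma padd_commute: "padd \<eta> \<gamma> = padd \<gamma> \<eta>"
  by (auto simp: padd_def fun_eq_iff)

lemma topples_padd:
  assumes "topples G s \<eta> \<zeta>"
  shows "topples G s (padd \<eta> \<gamma>) (padd \<zeta> \<gamma>)"
proof -
  obtain x where x: "x \<in> nonsink G s" "edge_count (arcs G) x UNIV \<le> \<eta> x" "\<zeta> = topple x \<eta>"
    using assms unfolding topples_iff by blast
  have "padd \<zeta> \<gamma> = topple x (padd \<eta> \<gamma>)"
    unfolding x(3) using x(1,2) by (auto simp: padd_def topple_def fun_eq_iff)
  moreover have "edge_count (arcs G) x UNIV \<le> padd \<eta> \<gamma> x"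
    using x by (simp add: padd_def)
  ultimately show ?thesis using x(1) unfolding topples_iff by blast
qed

lemma rtranclp_topples_padd:
  assumes "(topples G s)\<^sup>*\<^sup>* \<eta> \<zeta>"
  shows "(topples G s)\<^sup>*\<^sup>* (padd \<eta> \<gamma>) (padd \<zeta> \<gamma>)"
  using assms by induction (auto intro: rtranclp.rtrancl_into_rtrancl topples_padd)

lemma allowed_stabilization_padd:
  assumes "\<eta> \<in> allowed (arcs G) (nonsink G s)"
  shows "stabilization G s (padd \<eta> \<gamma>) \<in> allowed (arcs G) (nonsink G s)"
proof -
  have "burnable (arcs G) (nonsink G s) (padd \<eta> \<gamma>)"
    using assms by (auto simp: allowed_iff padd_def intro: burnable_mono)
  then show ?thesis
    using stabilization[OF padd_extensional[of \<eta> \<gamma>]] burnable_topples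
    unfolding allowed_iff by blast
qed

definition unit_particle :: "'v \<Rightarrow> 'v \<Rightarrow> nat" where
  "unit_particle x = (\<lambda>y. of_bool (y = x))"

definition drive :: "'v \<Rightarrow> ('v \<Rightarrow> nat) \<Rightarrow> 'v \<Rightarrow> nat" where
  "drive x \<eta> = stabilization G s (\<eta>(x := \<eta> x + 1))"

lemma drive_eq:
  assumes "x \<in> nonsink G s" "\<eta> \<in> extensional (nonsink G s)"
  shows "drive x \<eta> = stabilization G s (padd \<eta> (unit_particle x))"
proof -
  have "\<eta>(x := \<eta> x + 1) = padd \<eta> (unit_particle x)"
    using assms by (auto simp: padd_def unit_particle_def fun_eq_iff extensional_def)
  then show ?thesis by (simp only: drive_def)
qed

subsection \<open>Bijectivity of the particle addition operators\<close>

text \<open>The particles that the sink would send out in one toppling.\<close>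

definition burning_config :: "'v \<Rightarrow> nat" where
  "burning_config = (\<lambda>y \<in> nonsink G s. edge_count (arcs G) y {s})"

text \<open>The sandpile \<eta> after the sink and all vertices of \<open>B\<close> have toppled
  once. On \<open>B\<close> the particles received are already cancelled against the degree, so that
  a single subtraction remains.\<close>

definition after_burning :: "('v \<Rightarrow> nat) \<Rightarrow> 'v set \<Rightarrow> 'v \<Rightarrow> nat" where
  "after_burning \<eta> B = (\<lambda>y \<in> nonsink G s.
    if y \<in> B then \<eta> y - edge_count (arcs G) y (nonsink G s - B)
    else \<eta> y + edge_count (arcs G) y (insert s B))"

lemma edge_count_insert:
  assumes "x \<notin> F"
  shows "edge_count (arcs G) y (insert x F) = edge_count (arcs G) y {x} + edge_count (arcs G) y F"
  using edge_count_Un[of "arcs G" "{x}" F y] assms by simp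

lemma after_burning_insert:
  assumes B: "\<And>y. y \<in> B \<Longrightarrow> edge_count (arcs G) y (nonsink G s - B) \<le> \<eta> y" "B \<subseteq> nonsink G s"
    and x: "x \<in> nonsink G s - B" "edge_count (arcs G) x (nonsink G s - B) \<le> \<eta> x"
  shows "topples G s (after_burning \<eta> B) (after_burning \<eta> (insert x B))"
    and "\<And>y. y \<in> insert x B \<Longrightarrow> edge_count (arcs G) y (nonsink G s - insert x B) \<le> \<eta> y"
proof -
  let ?V = "nonsink G s" and ?E = "edge_count (arcs G)"
  have sV: "s \<notin> ?V" by (simp add: nonsink_def)
  have rest: "?E y (?V - B) = ?E y {x} + ?E y (?V - insert x B)" for y
  proof -
    have "?V - B = insert x (?V - insert x B)" using x(1) by auto
    then show ?thesis using edge_count_insert[of x "?V - insert x B" y] by simp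
  qed
  have burnt: "?E y (insert s (insert x B)) = ?E y {x} + ?E y (insert s B)" for y
  proof -
    have "x \<notin> insert s B" "insert s (insert x B) = insert x (insert s B)" using x(1) sV by auto
    then show ?thesis using edge_count_insert[of x "insert s B" y] by simp
  qed
  have degx: "?E x UNIV = ?E x (?V - B) + ?E x (insert s B)"
  proof -
    have "?E x UNIV = ?E x ((?V - B) \<union> insert s B)"
      by (rule edge_count_cong_joins) (use verts_eq in \<open>auto dest: joins_in_verts\<close>)
    also have "\<dots> = ?E x (?V - B) + ?E x (insert s B)"
      by (rule edge_count_Un) (use sV in auto)
    finally show ?thesis .
  qed
  have self: "?E x {x} = 0" by (simp add: edge_count_self)
  show "?E y (?V - insert x B) \<le> \<eta> y" if y: "y \<in> insert x B" for y
  proof -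
    have "?E y (?V - B) \<le> \<eta> y" using y B(1) x(2) by auto
    then show ?thesis using rest[of y] by simp
  qed
  have "after_burning \<eta> (insert x B) = topple x (after_burning \<eta> B)"
  proof
    fix y
    consider "y \<notin> ?V" | "y = x" | "y \<in> B" | "y \<in> ?V" "y \<noteq> x" "y \<notin> B" by blast
    then show "after_burning \<eta> (insert x B) y = topple x (after_burning \<eta> B) y"
    proof cases
      case 1
      then show ?thesis by (simp add: after_burning_def topple_def)
    next
      case 2
      have "after_burning \<eta> (insert x B) x = \<eta> x - ?E x (?V - insert x B)"
        using x(1) by (simp add: after_burning_def)
      also have "\<dots> = \<eta> x + ?E x (insert s B) - ?E x UNIV"
        using rest[of x] self degx by simp
      also have "\<dots> = topple x (after_burning \<eta> B) x"
        using x(1) by (simp add: topple_self after_burning_def)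
      finally show ?thesis using 2 by simp
    next
      case 3
      then have y: "y \<in> ?V" "y \<noteq> x" using B(2) x(1) by auto
      have "after_burning \<eta> (insert x B) y = \<eta> y - ?E y (?V - insert x B)"
        using 3 y by (simp add: after_burning_def)
      \<comment> \<open>By the assumption on \<open>B\<close> the subtraction is not truncated, so
        \<open>?E y {x}\<close> can be taken out of it.\<close>
      also have "\<dots> = \<eta> y - ?E y (?V - B) + ?E y {x}"
        using rest[of y] B(1)[OF 3] by simp
      also have "\<dots> = topple x (after_burning \<eta> B) y"
        using 3 y by (simp add: topple_other after_burning_def)
      finally show ?thesis .
    next
      case 4
      then show ?thesis using burnt[of y] by (simp add: topple_other after_burning_def)
    qed
  qed
  moreover have "?E x UNIV \<le> after_burning \<eta> B x"
    using x degx by (simp add: after_burning_def)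
  ultimately show "topples G s (after_burning \<eta> B) (after_burning \<eta> (insert x B))"
    using x(1) unfolding topples_iff by blast
qed

text \<open>Dhar's burning algorithm as a toppling sequence: once the sink has toppled, all vertices
  topple once each in a burning order, and as every vertex including the sink has then toppled once,
  \<eta> is restored.\<close>

lemma burning:
  assumes "\<eta> \<in> allowed (arcs G) (nonsink G s)"
  shows "(topples G s)\<^sup>*\<^sup>* (padd \<eta> burning_config) \<eta>"
proof -
  let ?V = "nonsink G s"
  have \<eta>: "burnable (arcs G) ?V \<eta>" "\<eta> \<in> extensional ?V"
    using assms by (auto simp: allowed_iff stable_on_iff)
  have "(topples G s)\<^sup>*\<^sup>* (after_burning \<eta> B) \<eta>"
    if "B \<subseteq> ?V" "\<And>y. y \<in> B \<Longrightarrow> edge_count (arcs G) y (?V - B) \<le> \<eta> y" for B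
    using that
  proof (induction "card (?V - B)" arbitrary: B rule: less_induct)
    case less
    show ?case
    proof (cases "?V - B = {}")
      case True
      then have "B = ?V" using less.prems(1) by blast
      have "after_burning \<eta> ?V = \<eta>"
        using \<eta>(2) by (auto simp: after_burning_def fun_eq_iff extensional_def)
      then show ?thesis unfolding \<open>B = ?V\<close> by simp
    next
      case False
      then obtain x where x: "x \<in> ?V - B" "edge_count (arcs G) x (?V - B) \<le> \<eta> x"
        using \<eta>(1) unfolding burnable_def by blast
      have "?V - insert x B \<subset> ?V - B" using x(1) by blast
      then have "card (?V - insert x B) < card (?V - B)" by (intro psubset_card_mono) auto
      moreover have "insert x B \<subseteq> ?V" using x(1) less.prems(1) by blast
      moreover have "edge_count (arcs G) y (?V - insert x B) \<le> \<eta> y" if "y \<in> insert x B" for y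
        by (rule after_burning_insert(2)[where B = B and \<eta> = \<eta> and x = x, OF _ less.prems(1) x that])
          (rule less.prems(2))
      ultimately have "(topples G s)\<^sup>*\<^sup>* (after_burning \<eta> (insert x B)) \<eta>"
        by (rule less.hyps)
      moreover have "topples G s (after_burning \<eta> B) (after_burning \<eta> (insert x B))"
        by (rule after_burning_insert(1)[where B = B and \<eta> = \<eta> and x = x, OF _ less.prems(1) x])
          (rule less.prems(2))
      ultimately show ?thesis by (meson converse_rtranclp_into_rtranclp)
    qed
  qed
  from this[of "{}"] have "(topples G s)\<^sup>*\<^sup>* (after_burning \<eta> {}) \<eta>" by simp
  moreover have "after_burning \<eta> {} = padd \<eta> burning_config"
    by (auto simp: after_burning_def padd_def burning_config_def fun_eq_iff)
  ultimately show ?thesis by simp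
qed

definition pscale :: "nat \<Rightarrow> ('v \<Rightarrow> nat) \<Rightarrow> 'v \<Rightarrow> nat" where
  "pscale n \<gamma> = (\<lambda>y \<in> nonsink G s. n * \<gamma> y)"

lemma pscale_Suc: "pscale (Suc n) \<gamma> = padd \<gamma> (pscale n \<gamma>)"
  by (auto simp: pscale_def padd_def fun_eq_iff)

lemma pscale_mult: "pscale n (pscale k \<gamma>) = pscale (n * k) \<gamma>"
  by (auto simp: pscale_def fun_eq_iff)

lemma burning_scaled:
  assumes "\<eta> \<in> allowed (arcs G) (nonsink G s)"
  shows "(topples G s)\<^sup>*\<^sup>* (padd \<eta> (pscale n burning_config)) \<eta>"
proof (induction n)
  case 0
  have "\<eta> \<in> extensional (nonsink G s)" using assms by (auto simp: allowed_iff stable_on_iff)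
  then have "padd \<eta> (pscale 0 burning_config) = \<eta>"
    by (auto simp: padd_def pscale_def fun_eq_iff extensional_def)
  then show ?case by simp
next
  case (Suc n)
  have "(topples G s)\<^sup>*\<^sup>* (padd (padd \<eta> burning_config) (pscale n burning_config))
      (padd \<eta> (pscale n burning_config))"
    by (rule rtranclp_topples_padd[OF burning[OF assms]])
  then show ?case unfolding pscale_Suc padd_assoc using Suc by (rule rtranclp_trans)
qed

lemma rtranclp_topples_pscale:
  assumes "(topples G s)\<^sup>*\<^sup>* \<eta> \<zeta>"
  shows "(topples G s)\<^sup>*\<^sup>* (pscale n \<eta>) (pscale n \<zeta>)"
proof (induction n)
  case 0
  show ?case by (simp add: pscale_def)
next
  case (Suc n)
  have "(topples G s)\<^sup>*\<^sup>* (padd \<eta> (pscale n \<eta>)) (padd \<zeta> (pscale n \<eta>))"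
    by (rule rtranclp_topples_padd[OF assms])
  moreover have "(topples G s)\<^sup>*\<^sup>* (padd \<zeta> (pscale n \<eta>)) (padd \<zeta> (pscale n \<zeta>))"
    unfolding padd_commute[of \<zeta>] by (rule rtranclp_topples_padd[OF Suc])
  ultimately show ?case unfolding pscale_Suc by (rule rtranclp_trans)
qed

text \<open>Some edge leaves the set of vertices that are not reached. If it leads to the sink,
  \<open>burning_config\<close> supplies a particle at its inner end; otherwise it leads to a
  reached vertex \<open>y\<close>, and scaling by the degree of \<open>y\<close> allows
  \<open>y\<close> to topple and send a particle back.\<close>

lemma burning_config_reaches:
  assumes "x \<in> nonsink G s"
  shows "\<exists>n \<gamma>. (topples G s)\<^sup>*\<^sup>* (pscale n burning_config) \<gamma> \<and> 0 < \<gamma> x"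
proof (rule ccontr)
  assume "\<not> ?thesis"
  let ?V = "nonsink G s"
  let ?reached = "\<lambda>x. \<exists>n \<gamma>. (topples G s)\<^sup>*\<^sup>* (pscale n burning_config) \<gamma> \<and> 0 < \<gamma> x"
  let ?F = "{x \<in> ?V. \<not> ?reached x}"
  have "?F \<subseteq> ?V" "?F \<noteq> {}" using assms \<open>\<not> ?reached x\<close> by auto
  then obtain e z y where e: "e \<in> arcs G" "joins e z y" "z \<in> ?F" "y \<notin> ?F"
    by (rule edge_leaving)
  have pos: "0 < edge_count (arcs G) z {y}"
    using e edge_count_pos_joins[OF subset_refl, of z "{y}"] by blast
  have z: "z \<in> ?V" using e(3) by simp
  have "?reached z"
  proof (cases "y = s")
    case True
    have "pscale 1 burning_config z = edge_count (arcs G) z {s}"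
      using z by (simp add: pscale_def burning_config_def)
    then have "0 < pscale 1 burning_config z" using pos True by simp
    then show ?thesis by blast
  next
    case False
    then have y: "y \<in> ?V" using joins_in_verts[OF e(1,2)] verts_eq by auto
    then obtain n \<gamma> where \<gamma>: "(topples G s)\<^sup>*\<^sup>* (pscale n burning_config) \<gamma>" "0 < \<gamma> y"
      using e(4) by blast
    let ?d = "edge_count (arcs G) y UNIV"
    have "(topples G s)\<^sup>*\<^sup>* (pscale (?d * n) burning_config) (pscale ?d \<gamma>)"
      unfolding pscale_mult[symmetric] by (rule rtranclp_topples_pscale[OF \<gamma>(1)])
    moreover have "topples G s (pscale ?d \<gamma>) (topple y (pscale ?d \<gamma>))"
      unfolding topples_iff using y \<gamma>(2) by (intro bexI[of _ y]) (auto simp: pscale_def)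
    ultimately have "(topples G s)\<^sup>*\<^sup>* (pscale (?d * n) burning_config) (topple y (pscale ?d \<gamma>))"
      by (meson rtranclp.rtrancl_into_rtrancl)
    moreover have "0 < topple y (pscale ?d \<gamma>) z"
      using z pos unfolding topple_def by simp
    ultimately show ?thesis by blast
  qed
  then show False using e(3) by blast
qed

lemma drive_allowed:
  assumes "x \<in> nonsink G s" "\<eta> \<in> allowed (arcs G) (nonsink G s)"
  shows "drive x \<eta> \<in> allowed (arcs G) (nonsink G s)"
proof -
  have "\<eta> \<in> extensional (nonsink G s)" using assms(2) by (simp add: allowed_iff stable_on_iff)
  then show ?thesis
    using drive_eq[OF assms(1)] allowed_stabilization_padd[OF assms(2)] by simp
qed

text \<open>As \<eta> absorbs multiples of \<open>burning_config\<close>, it is the stabilization of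
  \<open>padd \<eta> \<gamma>\<close> for some \<gamma> with a particle at \<open>x\<close>. Holding
  this particle back until the rest has been stabilized gives a preimage.\<close>

lemma drive_surj:
  assumes x: "x \<in> nonsink G s" and \<eta>: "\<eta> \<in> allowed (arcs G) (nonsink G s)"
  shows "\<exists>\<zeta>\<in>allowed (arcs G) (nonsink G s). drive x \<zeta> = \<eta>"
proof -
  let ?V = "nonsink G s"
  have stable: "stable_on G ?V \<eta>" using \<eta> by (simp add: allowed_iff)
  obtain n \<gamma> where \<gamma>: "(topples G s)\<^sup>*\<^sup>* (pscale n burning_config) \<gamma>" "0 < \<gamma> x"
    using burning_config_reaches[OF x] by blast
  have "(topples G s)\<^sup>*\<^sup>* (padd \<eta> (pscale n burning_config)) (padd \<eta> \<gamma>)"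
    unfolding padd_commute[of \<eta>] by (rule rtranclp_topples_padd[OF \<gamma>(1)])
  then have "(topples G s)\<^sup>*\<^sup>* (padd \<eta> (pscale n burning_config)) (stabilization G s (padd \<eta> \<gamma>))"
    using stabilization(1)[OF padd_extensional[of \<eta> \<gamma>]] by (rule rtranclp_trans)
  then have to_\<eta>: "stabilization G s (padd \<eta> \<gamma>) = \<eta>"
    using stabilization(2)[OF padd_extensional[of \<eta> \<gamma>]] burning_scaled[OF \<eta>] stable
    by (rule stable_unique)
  define \<gamma>' where "\<gamma>' = \<gamma>(x := \<gamma> x - 1)"
  define \<zeta> where "\<zeta> = stabilization G s (padd \<eta> \<gamma>')"
  have \<zeta>: "\<zeta> \<in> allowed (arcs G) ?V"
    unfolding \<zeta>_def by (rule allowed_stabilization_padd[OF \<eta>])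
  then have "\<zeta> \<in> extensional ?V" by (simp add: allowed_iff stable_on_iff)
  have "padd \<eta> \<gamma> = padd (padd \<eta> \<gamma>') (unit_particle x)"
    using \<gamma>(2) by (auto simp: padd_def \<gamma>'_def unit_particle_def fun_eq_iff)
  then have "(topples G s)\<^sup>*\<^sup>* (padd \<eta> \<gamma>) (padd \<zeta> (unit_particle x))"
    unfolding \<zeta>_def using rtranclp_topples_padd[OF stabilization(1)[OF padd_extensional]] by simp
  then have "(topples G s)\<^sup>*\<^sup>* (padd \<eta> \<gamma>) (drive x \<zeta>)"
    unfolding drive_eq[OF x \<open>\<zeta> \<in> extensional ?V\<close>]
    using stabilization(1)[OF padd_extensional[of \<zeta> "unit_particle x"]] by (rule rtranclp_trans)
  then have "stabilization G s (padd \<eta> \<gamma>) = drive x \<zeta>"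
    by (rule stabilization_eqI)
      (use drive_allowed[OF x \<zeta>] in \<open>simp add: allowed_iff\<close>)
  then show ?thesis using to_\<eta> \<zeta> by (intro bexI[of _ \<zeta>]) simp_all
qed

lemma drive_bij_betw:
  assumes "x \<in> nonsink G s"
  shows "bij_betw (drive x) (allowed (arcs G) (nonsink G s)) (allowed (arcs G) (nonsink G s))"
proof -
  let ?A = "allowed (arcs G) (nonsink G s)"
  have image: "drive x ` ?A = ?A"
    using drive_allowed[OF assms] drive_surj[OF assms] by (force simp: image_iff)
  moreover have "inj_on (drive x) ?A"
    using finite_allowed[OF finite_nonsink] by (rule finite_surj_inj) (simp add: image)
  ultimately show ?thesis by (simp add: bij_betw_def)
qed

text \<open>Particles can be added one at a time at vertices below their maximal value, without any
  toppling.\<close>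

lemma reaches_max_stable:
  assumes "\<eta> \<in> X" "\<And>\<zeta>. \<zeta> \<in> X \<Longrightarrow> stable_on G (nonsink G s) \<zeta>"
    and "\<And>x \<zeta>. x \<in> nonsink G s \<Longrightarrow> \<zeta> \<in> X \<Longrightarrow> drive x \<zeta> \<in> X"
  shows "max_stable \<in> X"
  using assms(1)
proof (induction "\<Sum>x\<in>nonsink G s. max_stable x - \<eta> x" arbitrary: \<eta> rule: less_induct)
  case less
  let ?V = "nonsink G s"
  have stable: "\<eta> \<in> extensional ?V" "\<And>x. x \<in> ?V \<Longrightarrow> \<eta> x < edge_count (arcs G) x UNIV"
    using assms(2)[OF less.prems] by (auto simp: stable_on_iff)
  show ?case
  proof (cases "\<exists>x\<in>?V. \<eta> x < max_stable x")
    case True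
    then obtain x where x: "x \<in> ?V" "\<eta> x < max_stable x" by blast
    let ?\<zeta> = "\<eta>(x := \<eta> x + 1)"
    have "stable_on G ?V ?\<zeta>"
      using stable x by (auto simp: stable_on_iff extensional_def max_stable_def)
    then have "drive x \<eta> = ?\<zeta>"
      unfolding drive_def by (intro stabilization_eqI) auto
    then have "?\<zeta> \<in> X" using assms(3)[OF x(1) less.prems] by simp
    moreover have "(\<Sum>y\<in>?V. max_stable y - ?\<zeta> y) < (\<Sum>y\<in>?V. max_stable y - \<eta> y)"
      by (rule sum_strict_mono_ex1) (use x in \<open>auto intro!: bexI[of _ x]\<close>)
    ultimately show ?thesis using less.hyps by blast
  next
    case False
    have "\<eta> = max_stable"
    proof
      fix x
      show "\<eta> x = max_stable x"
      proof (cases "x \<in> ?V")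
        case True
        then have "\<eta> x \<ge> max_stable x" using False by (simp add: not_less)
        moreover have "\<eta> x \<le> max_stable x" using True stable(2)[OF True] by (simp add: max_stable_def)
        ultimately show ?thesis by simp
      next
        case False
        then show ?thesis using stable(1) by (simp add: max_stable_def extensional_def)
      qed
    qed
    then show ?thesis using less.prems by simp
  qed
qed

subsection \<open>Recurrent sandpiles and the stationary distribution\<close>

lemma set_pmf_sandpile_kernel:
  assumes "nonsink G s \<noteq> {}"
  shows "set_pmf (sandpile_kernel G s \<eta>) = (\<lambda>x. drive x \<eta>) ` nonsink G s"
  using assms by (simp add: sandpile_kernel_def drive_def)

lemma closed_states_sandpile_kernel:
  assumes "nonsink G s \<noteq> {}"
  shows "closed_states (sandpile_kernel G s) X \<longleftrightarrow> (\<forall>x\<in>nonsink G s. \<forall>\<eta>\<in>X. drive x \<eta> \<in> X)"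
  unfolding closed_states_def set_pmf_sandpile_kernel[OF assms] by auto

text \<open>Each addition operator permutes the allowed sandpiles and maps the finite set
  \<open>X\<close> onto itself, so it preserves the complement too. If both were nonempty, both
  would contain \<open>max_stable\<close>.\<close>

lemma closed_subset_allowed:
  assumes V: "nonsink G s \<noteq> {}" and X: "X \<subseteq> allowed (arcs G) (nonsink G s)" "X \<noteq> {}"
    and closed: "closed_states (sandpile_kernel G s) X"
  shows "X = allowed (arcs G) (nonsink G s)"
proof (rule ccontr)
  let ?A = "allowed (arcs G) (nonsink G s)"
  assume "X \<noteq> ?A"
  then obtain \<zeta> where \<zeta>: "\<zeta> \<in> ?A - X" using X(1) by blast
  have drive: "drive x \<eta> \<in> X" if "x \<in> nonsink G s" "\<eta> \<in> X" for x \<eta>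
    using closed that unfolding closed_states_sandpile_kernel[OF V] by blast
  have stable: "stable_on G (nonsink G s) \<eta>" if "\<eta> \<in> ?A" for \<eta> using that by (simp add: allowed_iff)
  have "drive x \<eta> \<in> ?A - X" if x: "x \<in> nonsink G s" and \<eta>: "\<eta> \<in> ?A - X" for x \<eta>
  proof
    show "drive x \<eta> \<in> ?A" using drive_allowed[OF x] \<eta> by blast
    have inj: "inj_on (drive x) ?A" using drive_bij_betw[OF x] by (simp add: bij_betw_def)
    have "drive x ` X = X"
    proof (rule endo_inj_surj)
      show "finite X" using X(1) finite_allowed[OF finite_nonsink] by (rule finite_subset)
      show "drive x ` X \<subseteq> X" using drive[OF x] by blast
      show "inj_on (drive x) X" using inj X(1) by (rule inj_on_subset)
    qed
    show "drive x \<eta> \<notin> X"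
    proof
      assume "drive x \<eta> \<in> X"
      then obtain \<eta>' where "\<eta>' \<in> X" "drive x \<eta> = drive x \<eta>'" using \<open>drive x ` X = X\<close> by blast
      then have "\<eta> = \<eta>'" using inj_onD[OF inj, of \<eta> \<eta>'] \<eta> X(1) by blast
      then show False using \<open>\<eta>' \<in> X\<close> \<eta> by blast
    qed
  qed
  then have "max_stable \<in> ?A - X"
    using reaches_max_stable[OF \<zeta>] stable by blast
  moreover obtain \<eta> where "\<eta> \<in> X" using X(2) by blast
  then have "max_stable \<in> X"
    using reaches_max_stable[of \<eta> X] X(1) stable drive by blast
  ultimately show False by blast
qed

lemma closed_states_stable:
  assumes "nonsink G s \<noteq> {}"
  shows "closed_states (sandpile_kernel G s) {\<eta>. stable_on G (nonsink G s) \<eta>}"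
  unfolding closed_states_sandpile_kernel[OF assms]
  using drive_eq stabilization(2)[OF padd_extensional] by (auto simp: stable_on_iff)

lemma closed_states_allowed:
  assumes "nonsink G s \<noteq> {}"
  shows "closed_states (sandpile_kernel G s) (allowed (arcs G) (nonsink G s))"
  unfolding closed_states_sandpile_kernel[OF assms] using drive_allowed by blast

lemma closed_meets_allowed:
  assumes "nonsink G s \<noteq> {}" "X \<subseteq> {\<eta>. stable_on G (nonsink G s) \<eta>}" "X \<noteq> {}"
    and "closed_states (sandpile_kernel G s) X"
  shows "X \<inter> allowed (arcs G) (nonsink G s) \<noteq> {}"
proof -
  obtain \<eta> where "\<eta> \<in> X" using assms(3) by blast
  then have "max_stable \<in> X"
    using reaches_max_stable[of \<eta> X] assms(2,4) unfolding closed_states_sandpile_kernel[OF assms(1)]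
    by blast
  then show ?thesis using max_stable_allowed by blast
qed

text \<open>The allowed sandpiles form an irreducible closed class, and every nonempty closed set of
  stable sandpiles meets it.\<close>

theorem recurrent_sandpiles_eq_allowed:
  assumes V: "nonsink G s \<noteq> {}"
  shows "recurrent_sandpiles G s = allowed (arcs G) (nonsink G s)"
proof -
  let ?K = "sandpile_kernel G s" and ?A = "allowed (arcs G) (nonsink G s)"
  have fin: "finite (set_pmf (?K \<eta>))" for \<eta> by (simp add: set_pmf_sandpile_kernel[OF V])
  have "recurrent_state ?K \<eta> \<longleftrightarrow> \<eta> \<in> ?A" if stable: "stable_on G (nonsink G s) \<eta>" for \<eta>
  proof
    assume \<eta>: "\<eta> \<in> ?A"
    show "recurrent_state ?K \<eta>"
      by (rule recurrent_stateI[OF fin finite_allowed[OF finite_nonsink]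
            closed_states_allowed[OF V] \<eta>])
        (use closed_subset_allowed[OF V] \<eta> in blast)
  next
    assume "recurrent_state ?K \<eta>"
    moreover have "\<not> recurrent_state ?K \<eta>" if "\<eta> \<notin> ?A"
      by (rule not_recurrent_stateI[OF fin closed_states_allowed[OF V] that closed_states_stable[OF V]])
        (use closed_meets_allowed[OF V] stable in blast)+
    ultimately show "\<eta> \<in> ?A" by blast
  qed
  then show ?thesis by (auto simp: recurrent_sandpiles_def allowed_iff)
qed

text \<open>A step of the chain is a uniform mixture of bijections of the allowed sandpiles, and
  each of these preserves the uniform distribution.\<close>

theorem stationary_sandpile_eq_uniform:
  assumes V: "nonsink G s \<noteq> {}"
  shows "stationary_sandpile G s = pmf_of_set (allowed (arcs G) (nonsink G s))"
proof -
  let ?K = "sandpile_kernel G s" and ?A = "allowed (arcs G) (nonsink G s)"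
  have finA: "finite ?A" by (rule finite_allowed[OF finite_nonsink])
  have neA: "?A \<noteq> {}" using max_stable_allowed by blast
  have "bind_pmf (pmf_of_set ?A) ?K =
      bind_pmf (pmf_of_set (nonsink G s)) (\<lambda>x. map_pmf (drive x) (pmf_of_set ?A))"
    unfolding sandpile_kernel_def drive_def map_pmf_def by (rule bind_commute_pmf)
  also have "\<dots> = bind_pmf (pmf_of_set (nonsink G s)) (\<lambda>x. pmf_of_set ?A)"
    by (rule bind_pmf_cong[OF refl])
      (use V map_pmf_of_set_bij_betw[OF drive_bij_betw neA finA] in auto)
  finally have unif: "bind_pmf (pmf_of_set ?A) ?K = pmf_of_set ?A" by simp
  show ?thesis
    unfolding stationary_sandpile_def
  proof (rule the_equality)
    show "set_pmf (pmf_of_set ?A) \<subseteq> {\<eta>. stable_on G (nonsink G s) \<eta>} \<and>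
        bind_pmf (pmf_of_set ?A) ?K = pmf_of_set ?A"
      using unif finA neA by (auto simp: allowed_iff)
  next
    fix \<mu> assume \<mu>: "set_pmf \<mu> \<subseteq> {\<eta>. stable_on G (nonsink G s) \<eta>} \<and> bind_pmf \<mu> ?K = \<mu>"
    have "finite {\<eta>. stable_on G (nonsink G s) \<eta>}"
    proof (rule finite_subset)
      show "{\<eta>. stable_on G (nonsink G s) \<eta>} \<subseteq>
          PiE (nonsink G s) (\<lambda>x. {..<edge_count (arcs G) x UNIV})"
        by (auto simp: stable_on_iff PiE_def)
      show "finite (PiE (nonsink G s) (\<lambda>x. {..<edge_count (arcs G) x UNIV}))"
        by (rule finite_PiE) auto
    qed
    then have "finite (set_pmf \<mu>)" using \<mu> finite_subset by blast
    then have "set_pmf \<mu> \<subseteq> ?A"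
      by (rule stationary_support[OF _ closed_states_allowed[OF V]])
        (use \<mu> closed_meets_allowed[OF V] in blast)+
    then show "\<mu> = pmf_of_set ?A"
      using stationary_unique[OF finA neA unif closed_subset_allowed[OF V]] \<mu> by blast
  qed
qed

end

subsection \<open>The transfer current matrix\<close>

lemma sum_of_bool_eq_card:
  assumes "finite A"
  shows "(\<Sum>x\<in>A. of_bool (P x)) = real (card {x \<in> A. P x})"
  using assms by (simp add: Int_def)

context sink_multigraph
begin

definition incidence :: "'e \<Rightarrow> 'v \<Rightarrow> real" where
  "incidence e x = of_bool (x = tail G e) - of_bool (x = head G e)"

lemma laplacian_eq_incidence:
  assumes "A \<subseteq> arcs G"
  shows "laplacian A x y = (\<Sum>e\<in>A. incidence e x * incidence e y)"
proof -
  have fin: "finite A" using assms by (rule finite_arc_subset)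
  have loop: "tail G e \<noteq> head G e" if "e \<in> A" for e using that assms no_loops by blast
  show ?thesis
  proof (cases "x = y")
    case True
    have "(\<Sum>e\<in>A. incidence e x * incidence e x) =
        (\<Sum>e\<in>A. of_bool (tail G e = x \<or> head G e = x))"
      by (rule sum.cong) (auto simp: incidence_def dest: loop)
    also have "\<dots> = real (edge_count A x UNIV)"
      using sum_of_bool_eq_card[OF fin, of "\<lambda>e. tail G e = x \<or> head G e = x"]
      by (simp only: edge_count_def UNIV_I simp_thms)
    finally show ?thesis using True by (simp add: laplacian_def)
  next
    case False
    have "(\<Sum>e\<in>A. incidence e x * incidence e y) =
        (\<Sum>e\<in>A. - of_bool (tail G e = x \<and> head G e = y \<or> head G e = x \<and> tail G e = y))"
      by (rule sum.cong) (use False in \<open>auto simp: incidence_def\<close>)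
    also have "\<dots> = - real (edge_count A x {y})"
      using sum_of_bool_eq_card[OF fin,
          of "\<lambda>e. tail G e = x \<and> head G e = y \<or> head G e = x \<and> tail G e = y"]
      by (simp only: sum_negf edge_count_def singleton_iff)
    finally show ?thesis using False by (simp add: laplacian_def)
  qed
qed

lemma laplacian_sym: "laplacian A x y = laplacian A y x"
  by (simp add: laplacian_def edge_count_sym)

lemma net_flow_eq_incidence:
  "(\<Sum>f\<in>out_arcs G x. j f) - (\<Sum>f\<in>in_arcs G x. j f) = (\<Sum>f\<in>arcs G. incidence f x * j f)"
proof -
  have "(\<Sum>f\<in>arcs G. incidence f x * j f) =
      (\<Sum>f\<in>arcs G. if tail G f = x then j f else 0) - (\<Sum>f\<in>arcs G. if head G f = x then j f else 0)"
    unfolding sum_subtractf[symmetric] by (rule sum.cong) (auto simp: incidence_def)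
  then show ?thesis
    by (simp add: sum.If_cases out_arcs_def in_arcs_def Int_def)
qed

text \<open>Grounding the sink fixes the free additive constant and lets sums run over the nonsink
  vertices only.\<close>

lemma potential_difference:
  assumes "f \<in> arcs G" "h s = 0"
  shows "h (tail G f) - h (head G f) = (\<Sum>y\<in>nonsink G s. incidence f y * h y)"
proof -
  have at: "(\<Sum>y\<in>nonsink G s. of_bool (y = z) * h y) = h z" if "z \<in> verts G" for z
  proof (cases "z = s")
    case True
    then show ?thesis using assms(2) by (intro trans[OF sum.neutral]) (auto simp: nonsink_def)
  next
    case False
    then have "z \<in> nonsink G s" using that by (simp add: nonsink_def)
    then show ?thesis by (subst sum.remove[of _ z]) (auto intro: sum.neutral)
  qed
  show ?thesis
    unfolding incidence_def left_diff_distrib sum_subtractf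
    using at[OF tail_in_verts[OF assms(1)]] at[OF head_in_verts[OF assms(1)]] by simp
qed

lemma net_flow_laplacian:
  assumes "h s = 0"
  shows "(\<Sum>f\<in>arcs G. incidence f x * (h (tail G f) - h (head G f))) =
    (\<Sum>y\<in>nonsink G s. laplacian (arcs G) x y * h y)"
proof -
  have "(\<Sum>f\<in>arcs G. incidence f x * (h (tail G f) - h (head G f))) =
      (\<Sum>f\<in>arcs G. \<Sum>y\<in>nonsink G s. incidence f x * incidence f y * h y)"
    by (rule sum.cong) (simp_all add: potential_difference[where h = h, OF _ assms] sum_distrib_left mult.assoc)
  also have "\<dots> = (\<Sum>y\<in>nonsink G s. laplacian (arcs G) x y * h y)"
    unfolding laplacian_eq_incidence[OF subset_refl] sum_distrib_right by (rule sum.swap)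
  finally show ?thesis .
qed

lemma sum_incidence:
  assumes "e \<in> arcs G"
  shows "incidence e s + (\<Sum>x\<in>nonsink G s. incidence e x) = 0"
proof -
  have "(\<Sum>x\<in>verts G. of_bool (x = z)) = (1 :: real)" if "z \<in> verts G" for z
    using that by (subst sum.remove[of _ z]) (auto intro: sum.neutral)
  then have "(\<Sum>x\<in>verts G. incidence e x) = 0"
    using assms by (simp add: incidence_def sum_subtractf)
  moreover have "s \<notin> nonsink G s" by (simp add: nonsink_def)
  ultimately show ?thesis unfolding verts_eq by simp
qed

text \<open>The equation at the sink follows from the others, because net flows and sources both sum
  to 0 over all vertices.\<close>

lemma unit_current_potential_iff:
  assumes "e \<in> arcs G" "h s = 0"
  shows "unit_current_potential G e h \<longleftrightarrow>
    (\<forall>x\<in>nonsink G s. (\<Sum>y\<in>nonsink G s. laplacian (arcs G) x y * h y) = incidence e x)"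
    (is "_ \<longleftrightarrow> (\<forall>x\<in>_. ?L x = _)")
proof -
  have pot: "unit_current_potential G e h \<longleftrightarrow> (\<forall>x\<in>insert s (nonsink G s). ?L x = incidence e x)"
    unfolding unit_current_potential_def net_flow_eq_incidence net_flow_laplacian[where h = h, OF assms(2)]
      incidence_def[of e] verts_eq ..
  have "?L s + (\<Sum>x\<in>nonsink G s. ?L x) = 0"
  proof -
    let ?j = "\<lambda>f. h (tail G f) - h (head G f)"
    have "?L s + (\<Sum>x\<in>nonsink G s. ?L x) = (\<Sum>f\<in>arcs G. incidence f s * ?j f) +
        (\<Sum>x\<in>nonsink G s. \<Sum>f\<in>arcs G. incidence f x * ?j f)"
      by (simp only: net_flow_laplacian[where h = h, OF assms(2)])
    also have "\<dots> = (\<Sum>f\<in>arcs G. (incidence f s + (\<Sum>x\<in>nonsink G s. incidence f x)) * ?j f)"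
      by (subst sum.swap) (simp add: sum.distrib distrib_right sum_distrib_right)
    also have "\<dots> = 0" by (rule sum.neutral) (simp add: sum_incidence)
    finally show ?thesis .
  qed
  then have "?L s = incidence e s" if "\<forall>x\<in>nonsink G s. ?L x = incidence e x"
    using that sum_incidence[OF assms(1)] by simp
  then show ?thesis unfolding pot by blast
qed

text \<open>Applying \<open>N\<close> to the incidence vector of \<open>e\<close> gives the grounded
  potential. Any other potential is first shifted to vanish at the sink, which changes no
  current.\<close>

lemma transfer_current_eq:
  assumes N: "\<And>x z. x \<in> nonsink G s \<Longrightarrow> z \<in> nonsink G s \<Longrightarrow>
      (\<Sum>y\<in>nonsink G s. laplacian (arcs G) x y * N y z) = of_bool (x = z)"
    and e: "e \<in> arcs G" and f: "f \<in> arcs G"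
  shows "transfer_current G e f =
    (\<Sum>y\<in>nonsink G s. incidence f y * (\<Sum>z\<in>nonsink G s. N y z * incidence e z))"
proof -
  let ?V = "nonsink G s" and ?L = "laplacian (arcs G)"
  have sV: "s \<notin> ?V" by (simp add: nonsink_def)
  have single: "(\<Sum>z\<in>?V. of_bool (x = z) * c z) = c x" if "x \<in> ?V" for x and c :: "'v \<Rightarrow> real"
    using that by (subst sum.remove[of _ x]) (auto intro: sum.neutral)
  define h where "h y = (if y \<in> ?V then \<Sum>z\<in>?V. N y z * incidence e z else 0)" for y
  have hs: "h s = 0" using sV by (simp add: h_def)
  have Lh: "(\<Sum>y\<in>?V. ?L x y * h y) = incidence e x" if "x \<in> ?V" for x
  proof -
    have "(\<Sum>y\<in>?V. ?L x y * h y) = (\<Sum>y\<in>?V. \<Sum>z\<in>?V. ?L x y * N y z * incidence e z)"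
      by (rule sum.cong) (simp_all add: h_def sum_distrib_left mult.assoc)
    also have "\<dots> = (\<Sum>z\<in>?V. (\<Sum>y\<in>?V. ?L x y * N y z) * incidence e z)"
      unfolding sum_distrib_right by (rule sum.swap)
    also have "\<dots> = (\<Sum>z\<in>?V. of_bool (x = z) * incidence e z)"
      by (rule sum.cong) (simp_all add: N that)
    finally show ?thesis using single[OF that] by simp
  qed
  then have pot: "unit_current_potential G e h"
    using unit_current_potential_iff[where h = h, OF e hs] by blast
  have unique: "g (tail G f) - g (head G f) = h (tail G f) - h (head G f)"
    if g: "unit_current_potential G e g" for g
  proof -
    define k where "k y = g y - g s" for y
    have ks: "k s = 0" by (simp add: k_def)
    have "unit_current_potential G e k"
      using g by (simp add: unit_current_potential_def k_def)
    then have Lk: "(\<Sum>y\<in>?V. ?L x y * k y) = incidence e x" if "x \<in> ?V" for x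
      using unit_current_potential_iff[where h = k, OF e ks] that by blast
    have "k z = h z" if z: "z \<in> ?V" for z
    proof -
      \<comment> \<open>The Laplacian is symmetric, so the transpose of its right inverse
        \<open>N\<close> is a left inverse.\<close>
      have inv: "(\<Sum>x\<in>?V. N x z * (\<Sum>y\<in>?V. ?L x y * u y)) = u z" for u :: "'v \<Rightarrow> real"
      proof -
        have "(\<Sum>x\<in>?V. N x z * (\<Sum>y\<in>?V. ?L x y * u y)) = (\<Sum>x\<in>?V. \<Sum>y\<in>?V. ?L y x * N x z * u y)"
          by (rule sum.cong) (simp_all add: sum_distrib_left laplacian_sym[of "arcs G"] mult.assoc mult.left_commute)
        also have "\<dots> = (\<Sum>y\<in>?V. (\<Sum>x\<in>?V. ?L y x * N x z) * u y)"
          unfolding sum_distrib_right by (rule sum.swap)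
        also have "\<dots> = (\<Sum>y\<in>?V. of_bool (z = y) * u y)"
          by (rule sum.cong) (auto simp: N z)
        finally show ?thesis using single[OF z] by simp
      qed
      have "k z = (\<Sum>x\<in>?V. N x z * incidence e x)"
        unfolding inv[of k, symmetric] by (rule sum.cong) (simp_all add: Lk)
      also have "\<dots> = h z"
        unfolding inv[of h, symmetric] by (rule sum.cong) (simp_all add: Lh)
      finally show ?thesis .
    qed
    then have "k z = h z" if "z \<in> verts G" for z
      using that ks hs unfolding verts_eq by auto
    then have "k (tail G f) - k (head G f) = h (tail G f) - h (head G f)" using f by simp
    then show ?thesis by (simp add: k_def)
  qed
  have "transfer_current G e f = h (tail G f) - h (head G f)"
    unfolding transfer_current_def
  proof (rule the_equality)
    show "\<exists>g. unit_current_potential G e g \<and>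
        h (tail G f) - h (head G f) = g (tail G f) - g (head G f)"
      using pot by blast
    fix i assume "\<exists>g. unit_current_potential G e g \<and> i = g (tail G f) - g (head G f)"
    then show "i = h (tail G f) - h (head G f)" using unique by blast
  qed
  also have "\<dots> = (\<Sum>y\<in>?V. incidence f y * h y)" by (rule potential_difference[where h = h, OF f hs])
  also have "\<dots> = (\<Sum>y\<in>?V. incidence f y * (\<Sum>z\<in>?V. N y z * incidence e z))"
    by (rule sum.cong) (simp_all add: h_def)
  finally show ?thesis .
qed

text \<open>
  With the incidence matrix \<open>B\<close> of the arcs in \<open>J\<close>, deleting \<open>J\<close> turns the Laplacian \<open>L\<close> into
  \<open>L - B B\<^sup>T = L (I - L\<^sup>-\<^sup>1 B B\<^sup>T)\<close>, and \<open>det (I - L\<^sup>-\<^sup>1 B B\<^sup>T) = det (I - B\<^sup>T L\<^sup>-\<^sup>1 B)\<close>.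
\<close>

theorem det_laplacian_delete:
  assumes "J \<subseteq> arcs G"
  shows "det_on (nonsink G s) (laplacian (arcs G - J)) =
    det_on (nonsink G s) (laplacian (arcs G)) * det_on J (K_matrix G)"
proof -
  let ?V = "nonsink G s" and ?L = "laplacian (arcs G)"
  have finJ: "finite J" using assms by (rule finite_arc_subset)
  obtain N where N: "\<And>x z. x \<in> ?V \<Longrightarrow> z \<in> ?V \<Longrightarrow> (\<Sum>y\<in>?V. ?L x y * N y z) = of_bool (x = z)"
    using det_on_nonzero_inverse[OF finite_nonsink det_laplacian_nonzero] by blast
  define U where "U y e = (\<Sum>z\<in>?V. N y z * incidence e z)" for y e
  have single: "(\<Sum>z\<in>?V. of_bool (x = z) * c z) = c x" if "x \<in> ?V" for x and c :: "'v \<Rightarrow> real"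
    using that by (subst sum.remove[of _ x]) (auto intro: sum.neutral)
  have LU: "(\<Sum>y\<in>?V. ?L x y * U y e) = incidence e x" if "x \<in> ?V" for x e
  proof -
    have "(\<Sum>y\<in>?V. ?L x y * U y e) = (\<Sum>y\<in>?V. \<Sum>z\<in>?V. ?L x y * N y z * incidence e z)"
      by (simp add: U_def sum_distrib_left mult.assoc)
    also have "\<dots> = (\<Sum>z\<in>?V. (\<Sum>y\<in>?V. ?L x y * N y z) * incidence e z)"
      unfolding sum_distrib_right by (rule sum.swap)
    also have "\<dots> = (\<Sum>z\<in>?V. of_bool (x = z) * incidence e z)"
      by (rule sum.cong) (simp_all add: N that)
    finally show ?thesis using single[OF that] by simp
  qed
  have "laplacian (arcs G - J) x z =
      (\<Sum>y\<in>?V. ?L x y * (of_bool (y = z) - (\<Sum>e\<in>J. U y e * incidence e z)))"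
    if x: "x \<in> ?V" and z: "z \<in> ?V" for x z
  proof -
    have "(\<Sum>y\<in>?V. ?L x y * of_bool (y = z)) = ?L x z"
      using z by (subst sum.remove[of _ z]) (auto intro: sum.neutral)
    moreover have "(\<Sum>y\<in>?V. ?L x y * (\<Sum>e\<in>J. U y e * incidence e z)) =
        (\<Sum>e\<in>J. incidence e x * incidence e z)"
    proof -
      have "(\<Sum>y\<in>?V. ?L x y * (\<Sum>e\<in>J. U y e * incidence e z)) =
          (\<Sum>e\<in>J. (\<Sum>y\<in>?V. ?L x y * U y e) * incidence e z)"
        unfolding sum_distrib_left sum_distrib_right mult.assoc by (rule sum.swap)
      then show ?thesis by (simp add: LU[OF x])
    qed
    moreover have "laplacian (arcs G - J) x z = ?L x z - (\<Sum>e\<in>J. incidence e x * incidence e z)"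
      unfolding laplacian_eq_incidence[OF subset_refl] laplacian_eq_incidence[OF Diff_subset]
      by (rule sum_diff[OF finite_arcs assms])
    ultimately show ?thesis by (simp add: right_diff_distrib sum_subtractf)
  qed
  then have "det_on ?V (laplacian (arcs G - J)) = det_on ?V (\<lambda>x z.
      \<Sum>y\<in>?V. ?L x y * (of_bool (y = z) - (\<Sum>e\<in>J. U y e * incidence e z)))"
    by (intro det_on_cong) auto
  also have "\<dots> = det_on ?V ?L * det_on ?V (\<lambda>y z. of_bool (y = z) - (\<Sum>e\<in>J. U y e * incidence e z))"
    by (rule det_on_mult) simp
  also have "det_on ?V (\<lambda>y z. of_bool (y = z) - (\<Sum>e\<in>J. U y e * incidence e z)) =
      det_on J (\<lambda>f e. of_bool (f = e) - (\<Sum>x\<in>?V. incidence f x * U x e))"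
    by (rule det_on_one_minus_mult_commute) (use finJ in simp_all)
  \<comment> \<open>Sylvester's identity produces the transpose of \<open>K_matrix\<close>, which
    has the same determinant.\<close>
  also have "\<dots> = det_on J (\<lambda>f e. K_matrix G e f)"
  proof (rule det_on_cong[OF finJ])
    fix f e assume "f \<in> J" "e \<in> J"
    then have "e \<in> arcs G" "f \<in> arcs G" using assms by auto
    then show "of_bool (f = e) - (\<Sum>x\<in>?V. incidence f x * U x e) = K_matrix G e f"
      using transfer_current_eq[of N e f, OF N] by (auto simp: K_matrix_def U_def)
  qed
  also have "\<dots> = det_on J (K_matrix G)" by (rule det_on_transpose[OF finJ])
  finally show ?thesis .
qed

text \<open>Minimality is applied to a single recurrent extension, the one that is maximal outside
  \<open>W\<close>; the levels it yields account for all recurrent extensions.\<close>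

lemma prob_generalized_minimal:
  assumes min: "generalized_minimal G s W \<xi>"
  shows "\<exists>\<E>\<subseteq>touching_edges G W.
    measure_pmf.prob (stationary_sandpile G s) {\<eta>. restrict \<eta> W = \<xi>} = det_on \<E> (K_matrix G)"
proof -
  let ?V = "nonsink G s" and ?A = "allowed (arcs G) (nonsink G s)"
  have W: "W \<noteq> {}" "W \<subseteq> ?V" and \<xi>: "stable_on G W \<xi>"
    using min by (auto simp: generalized_minimal_def)
  have V: "?V \<noteq> {}" using W by auto
  note rec = recurrent_sandpiles_eq_allowed[OF V]
  obtain \<eta>0 where \<eta>0: "\<eta>0 \<in> ?A" "restrict \<eta>0 W = \<xi>"
    using min by (auto simp: generalized_minimal_def rec)
  \<comment> \<open>Raising values outside \<open>W\<close> to the stable maximum preserves the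
    burning test, so this extension of \<xi> inherits it from \<open>\<eta>0\<close>.\<close>
  define \<eta> where "\<eta> = (\<lambda>x\<in>?V. if x \<in> W then \<xi> x else edge_count (arcs G) x UNIV - 1)"
  have \<eta>0W: "\<eta>0 x = \<xi> x" if "x \<in> W" for x using \<eta>0(2) that by auto
  have "\<eta> x < edge_count (arcs G) x UNIV" if "x \<in> ?V" for x
    using that degree_pos[OF that] \<xi> by (auto simp: \<eta>_def stable_on_def deg_eq)
  then have "stable_on G ?V \<eta>" by (auto simp: stable_on_iff \<eta>_def)
  moreover have "burnable (arcs G) ?V \<eta>"
  proof (rule burnable_mono)
    show "burnable (arcs G) ?V \<eta>0" using \<eta>0(1) by (simp add: allowed_iff)
    fix x assume x: "x \<in> ?V"
    then have "\<eta>0 x < edge_count (arcs G) x UNIV" using \<eta>0(1) by (auto simp: allowed_def)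
    then show "\<eta>0 x \<le> \<eta> x" using x \<eta>0W by (auto simp: \<eta>_def)
  qed
  ultimately have \<eta>A: "\<eta> \<in> ?A" by (simp add: allowed_iff)
  have \<eta>W: "restrict \<eta> W = \<xi>"
    using W(2) \<xi> by (auto simp: \<eta>_def stable_on_def fun_eq_iff restrict_def PiE_def extensional_def)
  have "\<exists>lev. level_structure G s W \<eta> lev"
  proof (rule level_structure_exists[OF W(2) \<eta>A])
    fix x assume "x \<in> ?V - W"
    then show "Suc (\<eta> x) = edge_count (arcs G) x UNIV" using degree_pos[of x] by (simp add: \<eta>_def)
  next
    fix w assume "w \<in> W"
    then show "\<eta> w = 0 \<or> \<eta>(w := \<eta> w - 1) \<notin> ?A"
      using min \<eta>A \<eta>W by (auto simp: generalized_minimal_def rec)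
  qed
  then obtain lev where "level_structure G s W \<eta> lev" by blast
  then interpret level_structure G s W \<eta> lev .
  have finA: "finite ?A" by (rule finite_allowed[OF finite_nonsink])
  have "measure_pmf.prob (stationary_sandpile G s) {\<eta>. restrict \<eta> W = \<xi>} =
      real (card (?A \<inter> {\<eta>. restrict \<eta> W = \<xi>})) / real (card ?A)"
    unfolding stationary_sandpile_eq_uniform[OF V]
    by (rule measure_pmf_of_set) (use finA \<eta>A in auto)
  also have "?A \<inter> {\<eta>. restrict \<eta> W = \<xi>} = {\<zeta> \<in> ?A. restrict \<zeta> W = restrict \<eta> W}"
    unfolding \<eta>W by blast
  also have "real (card \<dots>) / real (card ?A) =
      det_on ?V (laplacian kept) / det_on ?V (laplacian (arcs G))"
    unfolding card_allowed_restrict card_allowed[OF kept_subset finite_nonsink]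
      card_allowed[OF subset_refl finite_nonsink] ..
  also have "\<dots> = det_on removed (K_matrix G)"
    unfolding kept_def det_laplacian_delete[OF removed_subset]
    using det_laplacian_nonzero by simp
  finally show ?thesis using removed_touching by blast
qed

end

theorem theorem1:
  fixes G :: "('v, 'e) pre_digraph" and s :: 'v and W :: "'v set" and \<xi> :: "'v \<Rightarrow> nat"
  assumes "sink_multigraph G s"
    and "W \<subseteq> nonsink G s"
  shows "(minimal_config G s W \<xi> \<longrightarrow>
            (\<exists>\<E> \<subseteq> touching_edges G W.
              measure_pmf.prob (stationary_sandpile G s) {\<eta>. restrict \<eta> W = \<xi>} =
                det_on \<E> (K_matrix G))) \<and>
         (generalized_minimal G s W \<xi> \<longrightarrow>
            (\<exists>\<E> \<subseteq> touching_edges G W.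
              measure_pmf.prob (stationary_sandpile G s) {\<eta>. restrict \<eta> W = \<xi>} =
                det_on \<E> (K_matrix G)))"
  using sink_multigraph.prob_generalized_minimal[OF assms(1)] by (simp add: minimal_config_def)

end
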